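(* Let $f:\mathbb{R}^n\to\mathbb{R}$ be convex and continuously differentiable with $L$-Lipschitz continuous gradient ($L>0$), let $A\in\mathbb{R}^{m\times n}$, $b\in\mathbb{R}^m$, and assume that $S:=\operatorname{argmin}\{f(x):Ax=b\}$ is nonempty, with minimum-norm element $x^*=P_S(0)$. Let $t_0>0$, $\delta,\rho,\gamma>0$, let $\beta:[t_0,\infty)\to[0,\infty)$ be continuous and bounded, and set $\beta_\infty^2:=\limsup_{t\to\infty}\beta(t)^2$. Let $$\varepsilon(t)=\frac{c}{t^r},\qquad c>0,\quad 0<r\le2.$$ Suppose either $0<r<2$, or $r=2$ and $$\delta\sqrt c>3+L\beta_\infty^2.$$ Then $\sigma>0$ can be chosen such that the following holds. For every solution $(x,\lambda)$ on $[t_0,\infty)$ (with $x\in C^2$, $\lambda\in C^1$) of $$ \begin{aligned} &\ddot x(t)+\delta\sqrt{\varepsilon(t)}\,\dot x(t)+\nabla f\bigl(x(t)+\beta(t)\dot x(t)\bigr)+A^\top\lambda(t)+\rho A^\top\bigl(A(x(t)+\beta(t)\dot x(t))-b\bigr)+\varepsilon(t)x(t)=0,\\ &\dot\lambda(t)=\frac{\gamma}{\sqrt{\varepsilon(t)}}\Bigl[A\Bigl(x(t)+\frac{\gamma}{\sigma\sqrt{\varepsilon(t)}}\dot x(t)\Bigr)-b\Bigr], \end{aligned} $$ with this $\sigma$, letting $\lambda^\dagger\in\mathbb{R}^m$ be the multiplier with $\nabla f(x^* )+A^\top\lambda^\dagger=0$ and $\lambda(t_0)-\lambda^\dagger\in\operatorname{Ran}A$,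 one has as $t\to\infty$: $$ x(t)\to x^*,\qquad \lambda(t)\to\lambda^\dagger, $$ $$ \mathcal{L}(x(t),\lambda^\dagger)-\mathcal{L}(x^*,\lambda^\dagger)=o(t^{-r}),\qquad \|Ax(t)-b\|=o(t^{-r}), $$ $$ |f(x(t))-f(x^* )|=o(t^{-r}),\qquad \|\dot x(t)\|=o(t^{-r/2}). $$
   Context: The Lagrangian is $\mathcal{L}(x,\lambda):=f(x)+\langle\lambda,Ax-b\rangle$. $P_S(0)$ is the projection of $0$ onto the closed convex set $S$. A multiplier $\lambda^\dagger$ with the two stated properties always exists and is unique (given $\lambda(t_0)$). *)

theory Defs
  imports "HOL-Analysis.Analysis" "HOL-Library.Landau_Symbols"
begin

definition constrained_argmin ::
  "(real^'n \<Rightarrow> real) \<Rightarrow> real^'n^'m \<Rightarrow> real^'m \<Rightarrow> (real^'n) set"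
  where "constrained_argmin f A b = {x. is_arg_min f (\<lambda>x. A *v x = b) x}"

definition lagrangian ::
  "(real^'n \<Rightarrow> real) \<Rightarrow> real^'n^'m \<Rightarrow> real^'m \<Rightarrow> real^'n \<Rightarrow> real^'m \<Rightarrow> real"
  where "lagrangian f A b x \<mu> = f x + \<mu> \<bullet> (A *v x - b)"

definition tikhonov :: "real \<Rightarrow> real \<Rightarrow> real \<Rightarrow> real"
  where "tikhonov c r t = c / t powr r"

(* Here x' is the velocity of x. All derivatives are taken within [t0, \<infinity>),
   hence one-sided at the initial time t0; continuity of x'' and \<mu>' on [t0, \<infinity>)
   expresses that x is of class C^2 and \<mu> of class C^1. *)
definition primal_dual_solution ::
  "(real^'n \<Rightarrow> real^'n) \<Rightarrow> real^'n^'m \<Rightarrow> real^'m \<Rightarrow> real \<Rightarrow> real \<Rightarrow> real \<Rightarrow> real \<Rightarrow>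
   (real \<Rightarrow> real) \<Rightarrow> (real \<Rightarrow> real) \<Rightarrow> real \<Rightarrow>
   (real \<Rightarrow> real^'n) \<Rightarrow> (real \<Rightarrow> real^'n) \<Rightarrow> (real \<Rightarrow> real^'m) \<Rightarrow> bool"
  where "primal_dual_solution grad A b \<delta> \<rho> \<gamma> \<sigma> \<beta> \<epsilon> t0 x x' \<mu> \<longleftrightarrow>
    (\<exists>x'' \<mu>'.
       continuous_on {t0..} x'' \<and> continuous_on {t0..} \<mu>' \<and>
       (\<forall>t\<ge>t0.
          (x has_vector_derivative x' t) (at t within {t0..}) \<and>
          (x' has_vector_derivative x'' t) (at t within {t0..}) \<and>
          (\<mu> has_vector_derivative \<mu>' t) (at t within {t0..}) \<and>
          x'' t + (\<delta> * sqrt (\<epsilon> t)) *\<^sub>R x' t + grad (x t + \<beta> t *\<^sub>R x' t)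
            + transpose A *v \<mu> t
            + \<rho> *\<^sub>R (transpose A *v (A *v (x t + \<beta> t *\<^sub>R x' t) - b))
            + \<epsilon> t *\<^sub>R x t = 0 \<and>
          \<mu>' t = (\<gamma> / sqrt (\<epsilon> t)) *\<^sub>R
            (A *v (x t + (\<gamma> / (\<sigma> * sqrt (\<epsilon> t))) *\<^sub>R x' t) - b)))"

end

theory Submission
  imports Defs
begin

text \<open>Let \<open>e = sqrt \<epsilon>\<close>, measure time by \<open>ds = e dt\<close> and put \<open>u = dx/ds\<close>, \<open>h = x - xs\<close>,
  \<open>m = \<mu> - \<mu>d\<close>, \<open>\<tau> = \<sigma> / \<gamma>\<close> and \<open>V = u + \<tau> h\<close>. The multiplier equation becomes
  \<open>dm/ds = \<gamma> / (\<tau> e\<^sup>2) A V\<close>, so that in the energy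
  \<open>W = G(x)/e\<^sup>2 + |V|\<^sup>2/2 + \<tau>/(2\<gamma>) |m|\<^sup>2 + (\<xi>+1)/2 |h|\<^sup>2 + xs \<bullet> h + k e\<^sup>2 (V \<bullet> A\<^sup>T m)\<close>,
  where \<open>G\<close> is the gap of the augmented Lagrangian at \<open>\<mu>d\<close>, the coupling terms cancel. The small
  last term creates dissipation in \<open>m\<close>, because \<open>A\<^sup>T\<close> is coercive on the range of \<open>A\<close>. With
  \<open>Q = G(x)/e\<^sup>2 + |u|\<^sup>2 + |h|\<^sup>2 + |m|\<^sup>2\<close> one obtains
  \<open>dW/ds \<le> - a Q - \<tau> (xs \<bullet> h) + o(1) (1 + Q)\<close>. Hence \<open>Q\<close> is bounded, \<open>G(x) \<rightarrow> 0\<close> and \<open>A h \<rightarrow> 0\<close>, all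
  cluster points of \<open>x\<close> are solutions, \<open>liminf (xs \<bullet> h) \<ge> 0\<close> since \<open>xs\<close> has minimal norm, and the
  linear decay then forces \<open>Q \<rightarrow> 0\<close>. Finally \<open>A h / e\<^sup>2 - (\<tau>/\<gamma>) m\<close> solves a damped linear equation
  driven by \<open>m\<close>, which gives the feasibility rate.

  The function \<open>q\<close> with \<open>de/dt = - (q/2) e\<^sup>2\<close> tends to \<open>q\<^sub>0 = 2 / sqrt c\<close> if \<open>r = 2\<close> and to \<open>q\<^sub>0 = 0\<close>
  otherwise. A parameter with \<open>q\<^sub>0 < \<tau> < \<delta> - q\<^sub>0 / 2\<close> exists iff \<open>\<delta> > 3 q\<^sub>0 / 2\<close>, that is
  \<open>\<delta> sqrt c > 3\<close> in the critical case. The contribution of \<open>\<beta>\<close> is absorbed by convexity.\<close>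

section \<open>Linear decay and convex gradients\<close>

lemma inner_has_real_derivative:
  assumes "(f has_vector_derivative f') (at t)" "(g has_vector_derivative g') (at t)"
  shows "((\<lambda>t. f t \<bullet> g t) has_real_derivative f t \<bullet> g' + f' \<bullet> g t) (at t)"
proof -
  have "((\<lambda>t. f t \<bullet> g t) has_derivative (\<lambda>h. f t \<bullet> (h *\<^sub>R g') + (h *\<^sub>R f') \<bullet> g t)) (at t)"
    using assms unfolding has_vector_derivative_def by (rule has_derivative_inner)
  moreover have "(\<lambda>h. f t \<bullet> (h *\<^sub>R g') + (h *\<^sub>R f') \<bullet> g t) = (*) (f t \<bullet> g' + f' \<bullet> g t)"
    by (auto simp: algebra_simps)
  ultimately show ?thesis by (simp add: has_field_derivative_def)
qed

text \<open>Gronwall's inequality in the time \<open>S\<close>, which runs at speed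
  \<open>e\<close>: the decay rate \<open>k\<close> drives \<open>w\<close> below every level above
  the equilibrium \<open>M / k\<close>.\<close>

lemma eventually_less_if_linear_decay:
  fixes w e S :: "real \<Rightarrow> real"
  assumes k: "k > 0" and m: "M < k * m"
    and S: "\<And>t. t \<ge> T \<Longrightarrow> (S has_real_derivative e t) (at t)" "filterlim S at_top at_top"
    and w: "\<forall>\<^sub>F t in at_top. \<exists>d. (w has_real_derivative d) (at t) \<and> d \<le> e t * (M - k * w t)"
  shows "\<forall>\<^sub>F t in at_top. w t < m"
proof -
  obtain T1 where T1: "\<And>t. t \<ge> T1 \<Longrightarrow> \<exists>d. (w has_real_derivative d) (at t) \<and> d \<le> e t * (M - k * w t)"
    using w unfolding eventually_at_top_linorder by blast
  define T' where "T' = max T T1"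
  \<comment> \<open>Integrating factor: the excess over the equilibrium times
    \<open>exp (k * S t)\<close> does not increase.\<close>
  define \<phi> where "\<phi> = (\<lambda>t. exp (k * S t) * (w t - M / k))"
  have dec: "\<phi> t \<le> \<phi> T'" if "t \<ge> T'" for t
  proof (rule DERIV_nonpos_imp_nonincreasing[OF that])
    fix s assume "T' \<le> s" "s \<le> t"
    then have s: "s \<ge> T" "s \<ge> T1" by (auto simp: T'_def)
    obtain d where d: "(w has_real_derivative d) (at s)" "d \<le> e s * (M - k * w s)"
      using T1[OF s(2)] by blast
    have "(\<phi> has_real_derivative exp (k * S s) * d + exp (k * S s) * (k * e s) * (w s - M / k)) (at s)"
      unfolding \<phi>_def by (auto intro!: derivative_eq_intros d(1) S(1) s)
    moreover have "exp (k * S s) * d + exp (k * S s) * (k * e s) * (w s - M / k)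
        = exp (k * S s) * (d - e s * (M - k * w s))"
      using k by (simp add: field_simps)
    moreover have "\<dots> \<le> 0" using d(2) by (simp add: mult_nonneg_nonpos)
    ultimately show "\<exists>y. (\<phi> has_real_derivative y) (at s) \<and> y \<le> 0" by metis
  qed
  have "filterlim (\<lambda>t. k * S t) at_top at_top"
    using k S(2) filterlim_tendsto_pos_mult_at_top[OF tendsto_const] by blast
  then have "((\<lambda>t. exp (- (k * S t))) \<longlongrightarrow> 0) at_top"
    by (intro filterlim_compose[OF exp_at_bot]) (simp add: filterlim_uminus_at_top)
  then have "((\<lambda>t. M / k + \<phi> T' * exp (- (k * S t))) \<longlongrightarrow> M / k + \<phi> T' * 0) at_top"
    by (intro tendsto_intros)
  moreover have "M / k + \<phi> T' * 0 < m" using k m by (simp add: field_simps)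
  ultimately have "\<forall>\<^sub>F t in at_top. M / k + \<phi> T' * exp (- (k * S t)) < m"
    by (rule order_tendstoD(2))
  then show ?thesis
    using eventually_ge_at_top[of T']
  proof eventually_elim
    case (elim t)
    have "w t - M / k = \<phi> t * exp (- (k * S t))" by (simp add: \<phi>_def exp_minus)
    also have "\<dots> \<le> \<phi> T' * exp (- (k * S t))" by (intro mult_right_mono dec elim) auto
    finally show ?case using elim by simp
  qed
qed

text \<open>The square \<open>w t \<bullet> w t\<close> satisfies the scalar inequality of the
  previous lemma, because Young's inequality pays for the forcing with half of the damping. The rate
  \<open>a\<close> may vary in time, as the rescaled constraint violation requires.\<close>

lemma tendsto_zero_if_linear_decay:
  fixes w :: "real \<Rightarrow> 'a::real_inner" and e S g :: "real \<Rightarrow> real"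
  assumes k: "k > 0"
    and S: "\<And>t. t \<ge> T \<Longrightarrow> (S has_real_derivative e t) (at t)" "filterlim S at_top at_top"
    and e: "\<forall>\<^sub>F t in at_top. e t > 0"
    and w: "\<forall>\<^sub>F t in at_top. (w has_vector_derivative e t *\<^sub>R (r t - a t *\<^sub>R w t)) (at t)"
    and a: "\<forall>\<^sub>F t in at_top. a t \<ge> k" and r: "(r \<longlongrightarrow> 0) at_top"
  shows "(w \<longlongrightarrow> 0) at_top"
proof (rule tendstoI)
  fix \<epsilon> :: real assume \<epsilon>: "\<epsilon> > 0"
  have "((\<lambda>t. (norm (r t))\<^sup>2 / k) \<longlongrightarrow> (norm (0::'a))\<^sup>2 / k) at_top"
    using k by (intro tendsto_intros r) auto
  then have sm: "\<forall>\<^sub>F t in at_top. (norm (r t))\<^sup>2 / k < k * \<epsilon>\<^sup>2 / 2"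
    using k \<epsilon> by (intro order_tendstoD(2)) auto
  have "\<forall>\<^sub>F t in at_top. w t \<bullet> w t < \<epsilon>\<^sup>2"
  proof (rule eventually_less_if_linear_decay[OF k _ S])
    show "k * \<epsilon>\<^sup>2 / 2 < k * \<epsilon>\<^sup>2" using k \<epsilon> by auto
    show "\<forall>\<^sub>F t in at_top. \<exists>d. ((\<lambda>t. w t \<bullet> w t) has_real_derivative d) (at t) \<and>
        d \<le> e t * (k * \<epsilon>\<^sup>2 / 2 - k * (w t \<bullet> w t))"
      using sm e w a
    proof eventually_elim
      case (elim t)
      have "((\<lambda>t. w t \<bullet> w t) has_real_derivative w t \<bullet> (e t *\<^sub>R (r t - a t *\<^sub>R w t)) + (e t *\<^sub>R (r t - a t *\<^sub>R w t)) \<bullet> w t) (at t)"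
        by (rule inner_has_real_derivative) (use elim in auto)
      moreover have "w t \<bullet> (e t *\<^sub>R (r t - a t *\<^sub>R w t)) + (e t *\<^sub>R (r t - a t *\<^sub>R w t)) \<bullet> w t
         = e t * (2 * (w t \<bullet> r t) - 2 * (a t * (w t \<bullet> w t)))"
        by (simp add: inner_commute algebra_simps)
      moreover have "2 * (w t \<bullet> r t) - 2 * (a t * (w t \<bullet> w t)) \<le> k * \<epsilon>\<^sup>2 / 2 - k * (w t \<bullet> w t)"
      proof -
        \<comment> \<open>Young's inequality with weight \<open>k\<close>: the cross term costs one
          of the two copies of \<open>k * (w t \<bullet> w t)\<close> that the damping
          supplies.\<close>
        have "0 \<le> (k *\<^sub>R w t - r t) \<bullet> (k *\<^sub>R w t - r t)" by simp
        also have "\<dots> = k * (k * (w t \<bullet> w t) - 2 * (w t \<bullet> r t)) + r t \<bullet> r t"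
          by (simp add: algebra_simps inner_commute)
        finally have "0 \<le> (k * (k * (w t \<bullet> w t) - 2 * (w t \<bullet> r t)) + r t \<bullet> r t) / k" using k by simp
        then have "2 * (w t \<bullet> r t) \<le> k * (w t \<bullet> w t) + (norm (r t))\<^sup>2 / k"
          using k by (simp add: add_divide_distrib power2_norm_eq_inner)
        moreover have "k * (w t \<bullet> w t) \<le> a t * (w t \<bullet> w t)"
          using elim by (intro mult_right_mono) auto
        ultimately show ?thesis using elim(1) by linarith
      qed
      ultimately show ?case using elim by (metis mult_left_mono less_imp_le)
    qed
  qed
  then show "\<forall>\<^sub>F t in at_top. dist (w t) 0 < \<epsilon>"
  proof eventually_elim
    case (elim t)
    then have "(norm (w t))\<^sup>2 < \<epsilon>\<^sup>2" by (simp add: power2_norm_eq_inner)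
    then show ?case using \<epsilon> by (simp add: power_less_imp_less_base)
  qed
qed

text \<open>Restricting \<open>f\<close> to the line through \<open>y\<close> and \<open>z\<close>
  reduces the claim to the tangent inequality in one variable.\<close>

lemma convex_on_gradient_ineq:
  fixes f :: "'a::real_inner \<Rightarrow> real"
  assumes "convex_on UNIV f" and "(f has_derivative (\<lambda>h. g \<bullet> h)) (at y)"
  shows "f z \<ge> f y + g \<bullet> (z - y)"
proof -
  define \<phi> where "\<phi> = (\<lambda>s. f (y + s *\<^sub>R (z - y)))"
  have "convex_on UNIV \<phi>"
  proof (rule convex_onI)
    fix t a b :: real assume t: "0 < t" "t < 1"
    have "y + ((1 - t) * a + t * b) *\<^sub>R (z - y) =
        (1 - t) *\<^sub>R (y + a *\<^sub>R (z - y)) + t *\<^sub>R (y + b *\<^sub>R (z - y))"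
      by (simp add: algebra_simps)
    then show "\<phi> ((1 - t) *\<^sub>R a + t *\<^sub>R b) \<le> (1 - t) * \<phi> a + t * \<phi> b"
      unfolding \<phi>_def using convex_onD[OF assms(1), of t "y + a *\<^sub>R (z - y)" "y + b *\<^sub>R (z - y)"] t
      by simp
  qed simp
  moreover have "(\<phi> has_real_derivative g \<bullet> (z - y)) (at 0)"
  proof -
    have "((\<lambda>s. y + s *\<^sub>R (z - y)) has_derivative (\<lambda>s. s *\<^sub>R (z - y))) (at 0)"
      by (auto intro!: derivative_eq_intros)
    from has_derivative_compose[OF this, of f "\<lambda>h. g \<bullet> h"] assms(2)
    have "(\<phi> has_derivative (\<lambda>s. s * (g \<bullet> (z - y)))) (at 0)" by (simp add: \<phi>_def)
    then show ?thesis by (simp add: has_field_derivative_def mult_commute_abs)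
  qed
  ultimately have "(g \<bullet> (z - y)) * (1 - 0) \<le> \<phi> 1 - \<phi> 0"
    by (intro convex_on_imp_above_tangent) auto
  then show ?thesis by (simp add: \<phi>_def)
qed

text \<open>A gradient step of length \<open>1 / (2 * \<Lambda>)\<close> cannot bring
  \<open>G\<close> below zero. The decrease comes from convexity at the end point \<open>z\<close>
  and the Lipschitz bound, without integration along the segment; this gives the constant 4.\<close>

lemma norm_gradient_sq_le:
  fixes G :: "'a::real_inner \<Rightarrow> real"
  assumes cvx: "\<And>y z. G z \<ge> G y + dG y \<bullet> (z - y)" and nn: "\<And>y. G y \<ge> 0"
    and L: "\<Lambda> > 0" "\<And>y z. norm (dG y - dG z) \<le> \<Lambda> * norm (y - z)"
  shows "(norm (dG y))\<^sup>2 \<le> 4 * \<Lambda> * G y"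
proof -
  define z where "z = y - (1 / (2 * \<Lambda>)) *\<^sub>R dG y"
  have zy: "z - y = - ((1 / (2 * \<Lambda>)) *\<^sub>R dG y)" by (simp add: z_def)
  have n: "norm (z - y) = norm (dG y) / (2 * \<Lambda>)" using L(1) by (simp add: zy)
  have "G y \<ge> G z + dG z \<bullet> (y - z)" by (rule cvx)
  also have "dG z \<bullet> (y - z) = (dG y - dG z) \<bullet> (z - y) - dG y \<bullet> (z - y)"
    by (simp add: algebra_simps)
  finally have "0 \<le> G y - (dG y - dG z) \<bullet> (z - y) + dG y \<bullet> (z - y)" using nn[of z] by simp
  moreover have "- ((dG y - dG z) \<bullet> (z - y)) \<le> \<Lambda> * norm (y - z) * norm (z - y)"
    using Cauchy_Schwarz_ineq2[of "dG y - dG z" "z - y"]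
      mult_right_mono[OF L(2)[of y z], of "norm (z - y)"] by simp
  moreover have "\<Lambda> * norm (y - z) * norm (z - y) = (norm (dG y))\<^sup>2 / (4 * \<Lambda>)"
    using L(1) unfolding norm_minus_commute[of y z] n by (simp add: power2_eq_square field_simps)
  moreover have "dG y \<bullet> (z - y) = - ((norm (dG y))\<^sup>2 / (2 * \<Lambda>))"
    by (simp add: zy power2_norm_eq_inner)
  ultimately have "0 \<le> G y + (norm (dG y))\<^sup>2 / (4 * \<Lambda>) - (norm (dG y))\<^sup>2 / (2 * \<Lambda>)" by linarith
  then show ?thesis using L(1) by (simp add: field_simps)
qed

lemma prod_le_sum_sq: "a * b \<le> a\<^sup>2 + (b::real)\<^sup>2"
proof -
  have "0 \<le> (a - b)\<^sup>2 + a\<^sup>2 + b\<^sup>2" by simp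
  then show ?thesis by (simp add: power2_diff)
qed

section \<open>The energy of the rescaled flow\<close>

text \<open>The system in the time \<open>S\<close>, with \<open>G\<close> abstracting the augmented
  gap. The assumption \<open>m_coercive\<close> encodes that \<open>m\<close> stays in the range of
  \<open>A\<close>, and \<open>xs_min_norm\<close> is the variational inequality for the projection
  of 0 onto the solution set.\<close>

locale rescaled_flow =
  fixes x u :: "real \<Rightarrow> 'a::euclidean_space" and m :: "real \<Rightarrow> 'b::euclidean_space"
    and A :: "'a \<Rightarrow> 'b" and G :: "'a \<Rightarrow> real" and dG :: "'a \<Rightarrow> 'a" and xs :: 'a
    and e q \<beta> S :: "real \<Rightarrow> real" and \<delta> \<gamma> \<tau> \<Lambda> B q\<^sub>0 \<kappa> T :: real
  assumes lin: "linear A"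
    and G_deriv: "\<And>y. (G has_derivative (\<lambda>v. dG y \<bullet> v)) (at y)"
    and G_grad: "\<And>y z. G z \<ge> G y + dG y \<bullet> (z - y)"
    and G_nonneg: "\<And>y. G y \<ge> 0" and G_xs: "G xs = 0"
    and \<Lambda>: "\<Lambda> > 0" and dG_lipschitz: "\<And>y z. norm (dG y - dG z) \<le> \<Lambda> * norm (y - z)"
    and xs_min_norm: "\<And>y. G y = 0 \<Longrightarrow> A y = A xs \<Longrightarrow> 0 \<le> xs \<bullet> (y - xs)"
    and e_pos: "\<And>t. t \<ge> T \<Longrightarrow> e t > 0"
    and e_deriv: "\<And>t. t \<ge> T \<Longrightarrow> (e has_real_derivative - (q t / 2) * (e t)\<^sup>2) (at t)"
    and e_lim: "(e \<longlongrightarrow> 0) at_top" and q_lim: "(q \<longlongrightarrow> q\<^sub>0) at_top"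
    and S_deriv: "\<And>t. t \<ge> T \<Longrightarrow> (S has_real_derivative e t) (at t)"
    and S_lim: "filterlim S at_top at_top"
    and \<beta>: "\<And>t. t \<ge> T \<Longrightarrow> 0 \<le> \<beta> t" "\<And>t. t \<ge> T \<Longrightarrow> \<beta> t \<le> B"
    and \<gamma>: "\<gamma> > 0" and q0: "q\<^sub>0 \<ge> 0" and \<tau>: "\<tau> > q\<^sub>0" and \<delta>: "\<delta> > \<tau> + q\<^sub>0 / 2"
    and \<kappa>: "\<kappa> > 0" and m_coercive: "\<And>t. t \<ge> T \<Longrightarrow> \<kappa> * norm (m t) \<le> norm (adjoint A (m t))"
    and x_deriv: "\<And>t. t \<ge> T \<Longrightarrow> (x has_vector_derivative e t *\<^sub>R u t) (at t)"
    and u_deriv: "\<And>t. t \<ge> T \<Longrightarrow> (u has_vector_derivative e t *\<^sub>R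
          (- ((\<delta> - q t / 2) *\<^sub>R u t) - x t
           - (1 / (e t)\<^sup>2) *\<^sub>R (dG (x t + (\<beta> t * e t) *\<^sub>R u t) + adjoint A (m t)))) (at t)"
    and m_deriv: "\<And>t. t \<ge> T \<Longrightarrow> (m has_vector_derivative e t *\<^sub>R
          ((\<gamma> / (\<tau> * (e t)\<^sup>2)) *\<^sub>R A (u t + \<tau> *\<^sub>R (x t - xs)))) (at t)"
begin

section \<open>The variables of the energy argument\<close>

definition h :: "real \<Rightarrow> 'a" where "h t = x t - xs"
definition V :: "real \<Rightarrow> 'a" where "V t = u t + \<tau> *\<^sub>R h t"
definition p :: "real \<Rightarrow> 'a" where "p t = adjoint A (m t)"
definition g :: "real \<Rightarrow> 'a" where "g t = dG (x t + (\<beta> t * e t) *\<^sub>R u t)"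
text \<open>Chosen so that, with the weight \<open>(\<xi> + 1) / 2\<close> of
  \<open>h t \<bullet> h t\<close> in \<open>W\<close>, the terms in
  \<open>u t \<bullet> h t\<close> cancel up to a multiple of
  \<open>q t - q\<^sub>0\<close>.\<close>

definition \<xi> :: real where "\<xi> = \<tau> * (\<delta> - \<tau> - q\<^sub>0 / 2)"

definition Q :: "real \<Rightarrow> real"
  where "Q t = G (x t) / (e t)\<^sup>2 + (norm (u t))\<^sup>2 + (norm (h t))\<^sup>2 + (norm (m t))\<^sup>2"

definition W :: "real \<Rightarrow> real \<Rightarrow> real"
  where "W k t = G (x t) / (e t)\<^sup>2 + (V t \<bullet> V t) / 2 + \<tau> / (2 * \<gamma>) * (m t \<bullet> m t)
    + (\<xi> + 1) / 2 * (h t \<bullet> h t) + xs \<bullet> h t + k * ((e t)\<^sup>2 * (V t \<bullet> p t))"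

text \<open>The derivative of \<open>W k\<close> in the time \<open>S\<close> after all
  cancellations. In the bracket multiplied by \<open>k\<close>, the term
  \<open>- p t \<bullet> p t\<close> is the dissipation gained in the multiplier; the term with
  \<open>A (V t)\<close> is its price and carries no small factor besides \<open>k\<close>.\<close>

definition DW :: "real \<Rightarrow> real \<Rightarrow> real"
  where "DW k t = q t * (G (x t) / (e t)\<^sup>2) + (dG (x t) \<bullet> u t - V t \<bullet> g t) / (e t)\<^sup>2
    - (\<delta> - \<tau> - q t / 2) * (u t \<bullet> u t) - \<tau> * (h t \<bullet> h t) - \<tau> * (h t \<bullet> xs)
    + \<tau> * (q t - q\<^sub>0) / 2 * (u t \<bullet> h t)
    + k * (- q t * (e t)\<^sup>2 * (V t \<bullet> p t)
         + (e t)\<^sup>2 * ((\<tau> - \<delta> + q t / 2) * (u t \<bullet> p t) - h t \<bullet> p t - xs \<bullet> p t)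
         - g t \<bullet> p t - p t \<bullet> p t + \<gamma> / \<tau> * (A (V t) \<bullet> A (V t)))"

section \<open>Derivatives along the flow\<close>

lemma \<tau>_pos: "\<tau> > 0" using \<tau> q0 by simp

lemma \<xi>_nonneg: "\<xi> \<ge> 0" using \<tau>_pos \<delta> by (simp add: \<xi>_def)

lemma adj: "adjoint A w \<bullet> v = w \<bullet> A v" "v \<bullet> adjoint A w = A v \<bullet> w"
  using adjoint_works[OF lin, of v w] by (auto simp: inner_commute)

lemma h_deriv: "t \<ge> T \<Longrightarrow> (h has_vector_derivative e t *\<^sub>R u t) (at t)"
  unfolding h_def by (auto intro!: derivative_eq_intros x_deriv)

lemma V_deriv:
  assumes "t \<ge> T"
  shows "(V has_vector_derivative e t *\<^sub>R ((\<tau> - \<delta> + q t / 2) *\<^sub>R u t - h t - xs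
    - (1 / (e t)\<^sup>2) *\<^sub>R (g t + p t))) (at t)"
proof -
  have "(V has_vector_derivative e t *\<^sub>R (- ((\<delta> - q t / 2) *\<^sub>R u t) - x t
           - (1 / (e t)\<^sup>2) *\<^sub>R (dG (x t + (\<beta> t * e t) *\<^sub>R u t) + adjoint A (m t)))
         + \<tau> *\<^sub>R (e t *\<^sub>R u t)) (at t)"
    unfolding V_def
    by (intro has_vector_derivative_add u_deriv[OF assms]
          bounded_linear.has_vector_derivative[OF bounded_linear_scaleR_right h_deriv[OF assms]])
  then show ?thesis
    by (rule back_subst[where P = "\<lambda>d. (V has_vector_derivative d) (at t)"])
      (simp add: g_def p_def h_def algebra_simps)
qed

lemma p_deriv:
  assumes "t \<ge> T"
  shows "(p has_vector_derivative e t *\<^sub>R ((\<gamma> / (\<tau> * (e t)\<^sup>2)) *\<^sub>R adjoint A (A (V t)))) (at t)"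
proof -
  have l: "linear (adjoint A)" by (rule adjoint_linear[OF lin])
  have "bounded_linear (adjoint A)" using l by (simp add: linear_conv_bounded_linear)
  from bounded_linear.has_vector_derivative[OF this m_deriv[OF assms]] show ?thesis
    by (simp add: p_def[abs_def] linear_cmul[OF l] V_def h_def)
qed

text \<open>Differentiating the weight produces the growth term with \<open>q t\<close>, which the
  dissipation of the gap at rate \<open>\<tau>\<close> must outweigh; hence the requirement
  \<open>\<tau> > q\<^sub>0\<close>.\<close>

lemma G_x_deriv:
  assumes "t \<ge> T"
  shows "((\<lambda>t. G (x t) / (e t)\<^sup>2) has_real_derivative
    e t * (q t * (G (x t) / (e t)\<^sup>2) + (dG (x t) \<bullet> u t) / (e t)\<^sup>2)) (at t)"
proof -
  have "((\<lambda>t. G (x t)) has_derivative (\<lambda>s. dG (x t) \<bullet> (s *\<^sub>R (e t *\<^sub>R u t)))) (at t)"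
    using has_derivative_compose[OF x_deriv[OF assms, unfolded has_vector_derivative_def] G_deriv] .
  moreover have "(\<lambda>s. dG (x t) \<bullet> (s *\<^sub>R (e t *\<^sub>R u t))) = (*) (e t * (dG (x t) \<bullet> u t))"
    by (auto simp: fun_eq_iff)
  ultimately have "((\<lambda>t. G (x t)) has_real_derivative e t * (dG (x t) \<bullet> u t)) (at t)"
    by (simp add: has_field_derivative_def)
  then have "((\<lambda>t. G (x t) / (e t)\<^sup>2) has_real_derivative
      (e t * (dG (x t) \<bullet> u t) * (e t)\<^sup>2 - G (x t) * (2 * e t * (- (q t / 2) * (e t)\<^sup>2))) /
      ((e t)\<^sup>2 * (e t)\<^sup>2)) (at t)"
    using e_pos[OF assms] by (intro DERIV_divide) (auto intro!: derivative_eq_intros e_deriv[OF assms])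
  then show ?thesis
    by (rule back_subst[where P = "\<lambda>d. (_ has_real_derivative d) (at t)"])
      (use e_pos[OF assms] in \<open>simp add: power2_eq_square divide_simps, simp add: algebra_simps\<close>)
qed

text \<open>Three cancellations fix the weights in \<open>W\<close>: the coupling
  \<open>V t \<bullet> p t\<close> against the derivative of \<open>m t \<bullet> m t\<close>, the
  product of \<open>xs\<close> and \<open>u t\<close> against the derivative of
  \<open>xs \<bullet> h t\<close>, and \<open>u t \<bullet> h t\<close> by the choice of
  \<open>\<xi>\<close>.\<close>

lemma W_deriv:
  assumes t: "t \<ge> T"
  shows "(W k has_real_derivative e t * DW k t) (at t)"
proof -
  define E where "E = (e t)\<^sup>2"
  have E: "E > 0" using e_pos[OF t] by (simp add: E_def)
  note d = inner_has_real_derivative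
  have de: "((\<lambda>t. (e t)\<^sup>2) has_real_derivative e t * (- q t * E)) (at t)"
    by (auto intro!: derivative_eq_intros e_deriv[OF t] simp: E_def power2_eq_square)
  have dx: "((\<lambda>t. xs \<bullet> h t) has_real_derivative xs \<bullet> (e t *\<^sub>R u t)) (at t)"
    using d[OF has_vector_derivative_const h_deriv[OF t], of xs] by simp
  note dV = V_deriv[OF t] and dp = p_deriv[OF t] and dh = h_deriv[OF t]
    and dm = m_deriv[OF t, folded h_def, folded V_def]
  define Vd where "Vd = (\<tau> - \<delta> + q t / 2) *\<^sub>R u t - h t - xs - (1 / E) *\<^sub>R (g t + p t)"
  define N where "N = A (V t) \<bullet> A (V t)"
  have Vd: "Vd \<bullet> w = (\<tau> - \<delta> + q t / 2) * (u t \<bullet> w) - h t \<bullet> w - xs \<bullet> w - (g t \<bullet> w + p t \<bullet> w) / E" for w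
    by (simp add: Vd_def algebra_simps add_divide_distrib)
  have "(W k has_real_derivative
      e t * (q t * (G (x t) / E) + (dG (x t) \<bullet> u t) / E)
      + (V t \<bullet> (e t *\<^sub>R Vd) + (e t *\<^sub>R Vd) \<bullet> V t) / 2
      + \<tau> / (2 * \<gamma>) * (m t \<bullet> (e t *\<^sub>R (\<gamma> / (\<tau> * E)) *\<^sub>R A (V t))
        + (e t *\<^sub>R (\<gamma> / (\<tau> * E)) *\<^sub>R A (V t)) \<bullet> m t)
      + (\<xi> + 1) / 2 * (h t \<bullet> (e t *\<^sub>R u t) + (e t *\<^sub>R u t) \<bullet> h t)
      + xs \<bullet> (e t *\<^sub>R u t)
      + k * (e t * (- q t * E) * (V t \<bullet> p t) + (V t \<bullet> (e t *\<^sub>R (\<gamma> / (\<tau> * E)) *\<^sub>R adjoint A (A (V t)))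
         + (e t *\<^sub>R Vd) \<bullet> p t) * (e t)\<^sup>2)) (at t)"
    unfolding W_def E_def Vd_def
    by (intro DERIV_add DERIV_cmult DERIV_cdivide DERIV_mult G_x_deriv[OF t] d dx de[unfolded E_def]
        dV[unfolded E_def] dp[unfolded E_def] dh dm[unfolded E_def])
  then show ?thesis
  proof (rule back_subst[where P = "\<lambda>d. (W k has_real_derivative d) (at t)"], goal_cases)
    case 1
    \<comment> \<open>The adjoint relation behind the cancellation: this product arises from the
      multiplier equation and, with opposite sign, from the velocity equation.\<close>
    have AVm: "A (V t) \<bullet> m t = V t \<bullet> p t" by (simp add: p_def adj)
    define X where "X = (\<tau> - \<delta> + q t / 2) * (u t \<bullet> u t + \<tau> * (u t \<bullet> h t))
      - (u t \<bullet> h t + \<tau> * (h t \<bullet> h t)) - (u t \<bullet> xs + \<tau> * (h t \<bullet> xs))"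
    define Y where "Y = (\<tau> - \<delta> + q t / 2) * (u t \<bullet> p t) - h t \<bullet> p t - xs \<bullet> p t"
    have VV: "Vd \<bullet> V t = X - (V t \<bullet> g t + V t \<bullet> p t) / E"
      unfolding Vd X_def inner_commute[of "g t"] inner_commute[of "p t"]
      by (simp add: V_def inner_add_right inner_commute)
    have Vp: "(Vd \<bullet> p t) * E = E * Y - g t \<bullet> p t - p t \<bullet> p t"
      using E unfolding Vd Y_def by (simp add: field_simps)
    have m1: "\<tau> / (2 * \<gamma>) * (e t * (\<gamma> / (\<tau> * E) * z) + e t * (\<gamma> / (\<tau> * E) * z)) = e t * (z / E)" for z
      using E \<tau>_pos \<gamma> by (simp add: field_simps)
    have m2: "(e t * (\<gamma> / (\<tau> * E) * N) + e t * (Vd \<bullet> p t)) * E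
        = e t * (\<gamma> / \<tau> * N + (E * Y - g t \<bullet> p t - p t \<bullet> p t))"
      unfolding Vp[symmetric] using E \<tau>_pos by (simp add: field_simps)
    show ?case
      unfolding DW_def E_def[symmetric] inner_scaleR_left inner_scaleR_right adj N_def[symmetric]
        inner_commute[of "V t" Vd] inner_commute[of "m t"] VV AVm m1 m2 Y_def[symmetric]
        inner_commute[of "h t" "u t"] inner_commute[of xs "u t"] X_def \<xi>_def
      by (simp add: algebra_simps add_divide_distrib diff_divide_distrib)
  qed
qed

section \<open>Bounds by the quantity \<open>Q\<close>\<close>

definition N :: real where "N = (SOME N. N > 0 \<and> (\<forall>v. norm (A v) \<le> N * norm v))"

lemma N_pos: "N > 0" and norm_A: "norm (A v) \<le> N * norm v"
proof -
  obtain N' where "N' > 0" "\<And>v. norm (A v) \<le> N' * norm v"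
    using linear_bounded_pos[OF lin] by blast
  then have "\<exists>N. N > 0 \<and> (\<forall>v. norm (A v) \<le> N * norm v)" by blast
  then have "N > 0 \<and> (\<forall>v. norm (A v) \<le> N * norm v)" unfolding N_def by (rule someI_ex)
  then show "N > 0" "norm (A v) \<le> N * norm v" by auto
qed

lemma norm_p: "norm (p t) \<le> N * norm (m t)"
proof -
  have "(norm (p t))\<^sup>2 = m t \<bullet> A (p t)" by (simp add: power2_norm_eq_inner p_def adj(1))
  also have "\<dots> \<le> norm (m t) * (N * norm (p t))"
    by (rule order_trans[OF norm_cauchy_schwarz]) (intro mult_left_mono norm_A norm_ge_zero)
  finally have "norm (p t) * norm (p t) \<le> (N * norm (m t)) * norm (p t)"
    by (simp add: power2_eq_square mult_ac)
  then show ?thesis using N_pos by (cases "norm (p t) = 0") auto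
qed

lemma inner_p: "\<bar>v \<bullet> p t\<bar> \<le> N * (norm v * norm (m t))"
proof -
  have "\<bar>v \<bullet> p t\<bar> \<le> norm v * norm (p t)" by (rule Cauchy_Schwarz_ineq2)
  also have "\<dots> \<le> norm v * (N * norm (m t))" by (intro mult_left_mono norm_p norm_ge_zero)
  finally show ?thesis by (simp add: mult_ac)
qed

text \<open>A parallelogram estimate. Together with \<open>u_sq\<close> it makes \<open>V\<close>
  and \<open>u\<close> interchangeable up to a multiple of the square of \<open>h\<close>: the
  energy \<open>W\<close> contains \<open>V\<close>, whereas \<open>Q\<close> contains
  \<open>u\<close>.\<close>

lemma V_sq: "(norm (V t))\<^sup>2 \<le> 2 * ((norm (u t))\<^sup>2 + \<tau>\<^sup>2 * (norm (h t))\<^sup>2)"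
proof -
  have "0 \<le> (u t - \<tau> *\<^sub>R h t) \<bullet> (u t - \<tau> *\<^sub>R h t)" by simp
  then show ?thesis
    by (simp add: V_def power2_norm_eq_inner algebra_simps inner_commute power2_eq_square[of \<tau>])
qed

lemma u_sq: "(norm (u t))\<^sup>2 \<le> 2 * ((norm (V t))\<^sup>2 + \<tau>\<^sup>2 * (norm (h t))\<^sup>2)"
proof -
  have "0 \<le> (u t + 2 *\<^sub>R \<tau> *\<^sub>R h t) \<bullet> (u t + 2 *\<^sub>R \<tau> *\<^sub>R h t)" by simp
  then show ?thesis
    by (simp add: V_def power2_norm_eq_inner algebra_simps inner_commute power2_eq_square[of \<tau>])
qed

text \<open>The bilinear terms in the derivative of the energy are dominated by \<open>Q\<close>. A
  bare \<open>norm (m t)\<close>, as it appears when \<open>p t\<close> is paired with the fixed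
  vector \<open>xs\<close>, costs \<open>1 + Q t\<close>.\<close>

lemma Q_bounds:
  shows "norm (u t) * norm (h t) \<le> Q t" "norm (u t) * norm (m t) \<le> Q t"
    "norm (h t) * norm (m t) \<le> Q t" "norm (m t) \<le> 1 + Q t" "0 \<le> Q t" "0 \<le> G (x t) / (e t)\<^sup>2"
    "(norm (h t))\<^sup>2 \<le> Q t" "(norm (m t))\<^sup>2 \<le> Q t" "(norm (u t))\<^sup>2 \<le> Q t"
    "G (x t) / (e t)\<^sup>2 \<le> Q t"
    "sqrt (G (x t) / (e t)\<^sup>2) * norm (m t) \<le> Q t"
proof -
  show G0: "0 \<le> G (x t) / (e t)\<^sup>2" using G_nonneg by simp
  have *: "0 \<le> (norm (h t))\<^sup>2" "0 \<le> (norm (m t))\<^sup>2" "0 \<le> (norm (u t))\<^sup>2" by auto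
  show "0 \<le> Q t" "(norm (h t))\<^sup>2 \<le> Q t" "(norm (m t))\<^sup>2 \<le> Q t" "(norm (u t))\<^sup>2 \<le> Q t"
    "G (x t) / (e t)\<^sup>2 \<le> Q t"
    using G0 unfolding Q_def by auto
  show "norm (u t) * norm (h t) \<le> Q t" "norm (u t) * norm (m t) \<le> Q t"
    "norm (h t) * norm (m t) \<le> Q t"
    using prod_le_sum_sq[of "norm (u t)" "norm (h t)"] prod_le_sum_sq[of "norm (u t)" "norm (m t)"]
      prod_le_sum_sq[of "norm (h t)" "norm (m t)"] G0 * unfolding Q_def by linarith+
  show "norm (m t) \<le> 1 + Q t"
    using prod_le_sum_sq[of 1 "norm (m t)"] \<open>(norm (m t))\<^sup>2 \<le> Q t\<close> by simp
  show "sqrt (G (x t) / (e t)\<^sup>2) * norm (m t) \<le> Q t"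
    using prod_le_sum_sq[of "sqrt (G (x t) / (e t)\<^sup>2)" "norm (m t)"] * G0
    unfolding Q_def real_sqrt_pow2[OF G0] by linarith
qed

lemma V_p: "\<bar>V t \<bullet> p t\<bar> \<le> N * (1 + \<tau>) * Q t"
proof -
  have "\<bar>V t \<bullet> p t\<bar> \<le> N * (norm (V t) * norm (m t))" by (rule inner_p)
  also have "\<dots> \<le> N * ((norm (u t) + \<tau> * norm (h t)) * norm (m t))"
    unfolding V_def using N_pos \<tau>_pos norm_triangle_ineq[of "u t" "\<tau> *\<^sub>R h t"]
    by (intro mult_left_mono mult_right_mono) auto
  also have "\<dots> = N * (norm (u t) * norm (m t) + \<tau> * (norm (h t) * norm (m t)))"
    by (simp add: algebra_simps)
  also have "\<dots> \<le> N * (Q t + \<tau> * Q t)"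
    using N_pos \<tau>_pos Q_bounds by (intro mult_left_mono add_mono) auto
  finally show ?thesis by (simp add: algebra_simps)
qed

text \<open>The error \<open>dG x - g\<close> caused by evaluating the gradient at the extrapolated point is
  paid for by monotonicity of \<open>dG\<close> along \<open>u\<close>, so boundedness of \<open>\<beta>\<close> suffices.\<close>

lemma gradient_terms:
  assumes t: "t \<ge> T" and small: "\<tau> * B * e t \<le> 1"
  shows "dG (x t) \<bullet> u t - V t \<bullet> g t \<le> - \<tau> * G (x t)"
proof -
  define s where "s = \<beta> t * e t"
  define y where "y = x t + s *\<^sub>R u t"
  define P where "P = u t \<bullet> (g t - dG (x t))"
  have g: "g t = dG y" by (simp add: g_def y_def s_def)
  have s0: "s \<ge> 0" using \<beta>[OF t] e_pos[OF t] by (simp add: s_def)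
  have "\<tau> * s \<le> \<tau> * B * e t"
    using \<beta>[OF t] e_pos[OF t] \<tau>_pos by (simp add: s_def)
  then have s1: "\<tau> * s \<le> 1" using small by simp
  \<comment> \<open>Convexity from \<open>y\<close> to \<open>xs\<close> and from \<open>x t\<close>
    to \<open>y\<close>: adding the two eliminates \<open>G y\<close> and leaves the gap at
    \<open>x t\<close> itself.\<close>
  have "G xs \<ge> G y + dG y \<bullet> (xs - y)" "G y \<ge> G (x t) + dG (x t) \<bullet> (y - x t)"
    by (rule G_grad)+
  then have "G (x t) + s * (dG (x t) \<bullet> u t) - g t \<bullet> h t - s * (g t \<bullet> u t) \<le> 0"
    by (simp add: G_xs g y_def h_def inner_diff_right inner_add_right)
  then have hg: "- (h t \<bullet> g t) \<le> - G (x t) + s * P"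
    by (simp add: P_def inner_diff_right inner_commute algebra_simps)
  \<comment> \<open>Monotonicity of the gradient gives \<open>s * P \<ge> 0\<close>, which decides
    the sign of \<open>P\<close> only for positive \<open>s\<close>; for \<open>s = 0\<close> both
    gradients coincide.\<close>
  have P: "(1 - \<tau> * s) * P \<ge> 0"
  proof (cases "s = 0")
    case True then show ?thesis by (simp add: P_def g y_def)
  next
    case False
    have "G (x t) \<ge> G y + dG y \<bullet> (x t - y)" "G y \<ge> G (x t) + dG (x t) \<bullet> (y - x t)"
      by (rule G_grad)+
    then have "s * P \<ge> 0"
      by (simp add: P_def g y_def inner_diff_right inner_commute algebra_simps)
    then show ?thesis using s0 s1 False by (simp add: zero_le_mult_iff)
  qed
  have "dG (x t) \<bullet> u t - V t \<bullet> g t = - P - \<tau> * (h t \<bullet> g t)"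
    by (simp add: P_def V_def inner_add_left inner_diff_right inner_commute[of "dG (x t)"])
  also have "\<dots> \<le> - P + \<tau> * (- G (x t) + s * P)"
    using mult_left_mono[OF hg, of \<tau>] \<tau>_pos by simp
  also have "\<dots> \<le> - \<tau> * G (x t)" using P by (simp add: algebra_simps)
  finally show ?thesis .
qed

text \<open>Collects the coefficients that vanish in the limit: the first summand stems from the
  incomplete cancellation of \<open>u t \<bullet> h t\<close>, the others from the cross term of the
  energy, where each retains a factor \<open>e t\<close>.\<close>

definition \<psi> :: "real \<Rightarrow> real \<Rightarrow> real"
  where "\<psi> k t = \<tau> * \<bar>q t - q\<^sub>0\<bar> / 2
    + k * (N * ((e t)\<^sup>2 * (\<bar>q t\<bar> * (1 + \<tau>) + \<bar>\<tau> - \<delta> + q t / 2\<bar> + 1 + norm xs)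
      + e t * (2 * sqrt \<Lambda> + \<Lambda> * B)))"

lemma \<psi>_lim: "(\<psi> k \<longlongrightarrow> 0) at_top"
proof -
  have "(\<psi> k \<longlongrightarrow> \<tau> * \<bar>q\<^sub>0 - q\<^sub>0\<bar> / 2
    + k * (N * (0\<^sup>2 * (\<bar>q\<^sub>0\<bar> * (1 + \<tau>) + \<bar>\<tau> - \<delta> + q\<^sub>0 / 2\<bar> + 1 + norm xs)
      + 0 * (2 * sqrt \<Lambda> + \<Lambda> * B)))) at_top"
    unfolding \<psi>_def by (intro tendsto_intros q_lim e_lim) auto
  then show ?thesis by simp
qed

text \<open>Both parts of the gradient at the extrapolated point gain a factor \<open>e t\<close>:
  the gradient at \<open>x t\<close> by \<open>norm_gradient_sq_le\<close>, because \<open>Q\<close>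
  controls \<open>G\<close> divided by \<open>(e t)\<^sup>2\<close>, and the extrapolation error by
  Lipschitz continuity and the bound \<open>B\<close>.\<close>

lemma g_p:
  assumes t: "t \<ge> T"
  shows "\<bar>g t \<bullet> p t\<bar> \<le> N * e t * (2 * sqrt \<Lambda> + \<Lambda> * B) * Q t"
proof -
  have e: "e t > 0" using e_pos[OF t] .
  have "(norm (dG (x t)))\<^sup>2 \<le> 4 * \<Lambda> * G (x t)"
    by (rule norm_gradient_sq_le[OF G_grad G_nonneg \<Lambda> dG_lipschitz])
  then have "norm (dG (x t)) \<le> sqrt (4 * \<Lambda> * G (x t))" by (rule real_le_rsqrt)
  also have "\<dots> = 2 * sqrt \<Lambda> * e t * sqrt (G (x t) / (e t)\<^sup>2)"
    using e by (simp add: real_sqrt_mult real_sqrt_divide)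
  finally have 1: "norm (dG (x t)) \<le> 2 * sqrt \<Lambda> * e t * sqrt (G (x t) / (e t)\<^sup>2)" .
  have "norm (g t - dG (x t)) \<le> \<Lambda> * norm ((\<beta> t * e t) *\<^sub>R u t)"
    using dG_lipschitz[of "x t + (\<beta> t * e t) *\<^sub>R u t" "x t"] by (simp add: g_def)
  also have "\<dots> = \<Lambda> * (\<beta> t * (e t * norm (u t)))" using \<beta>[OF t] e by simp
  also have "\<dots> \<le> \<Lambda> * (B * (e t * norm (u t)))"
    using \<beta>[OF t] e \<Lambda> by (intro mult_left_mono mult_right_mono) auto
  finally have 2: "norm (g t - dG (x t)) \<le> \<Lambda> * (B * (e t * norm (u t)))" .
  have "norm (g t) \<le> norm (dG (x t)) + norm (g t - dG (x t))"
    using norm_triangle_ineq[of "dG (x t)" "g t - dG (x t)"] by simp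
  then have "norm (g t) \<le> 2 * sqrt \<Lambda> * e t * sqrt (G (x t) / (e t)\<^sup>2) + \<Lambda> * (B * (e t * norm (u t)))"
    using 1 2 by linarith
  then have "norm (g t) * norm (m t) \<le>
    (2 * sqrt \<Lambda> * e t * sqrt (G (x t) / (e t)\<^sup>2) + \<Lambda> * (B * (e t * norm (u t)))) * norm (m t)"
    by (intro mult_right_mono) auto
  also have "\<dots> = 2 * sqrt \<Lambda> * e t * (sqrt (G (x t) / (e t)\<^sup>2) * norm (m t))
      + \<Lambda> * B * e t * (norm (u t) * norm (m t))"
    by (simp only: algebra_simps)
  also have "\<dots> \<le> 2 * sqrt \<Lambda> * e t * Q t + \<Lambda> * B * e t * Q t"
    using \<Lambda> e \<beta>[OF t] Q_bounds(2,11) by (intro add_mono mult_left_mono) auto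
  finally have "norm (g t) * norm (m t) \<le> e t * (2 * sqrt \<Lambda> + \<Lambda> * B) * Q t"
    by (simp add: algebra_simps)
  from order_trans[OF inner_p mult_left_mono[OF this]] N_pos show ?thesis by (simp add: mult.assoc)
qed

text \<open>Sorts the derivative into dissipation, the price term of the multiplier dissipation, the
  linear term \<open>h t \<bullet> xs\<close> and the errors gathered in \<open>\<psi>\<close>. The
  linear term stays as it is, since control of its sign comes only from the minimality of
  \<open>xs\<close>.\<close>

lemma DW_le:
  assumes t: "t \<ge> T" and small: "\<tau> * B * e t \<le> 1" and k: "k \<ge> 0"
  shows "DW k t \<le> - (\<tau> - q t) * (G (x t) / (e t)\<^sup>2) - (\<delta> - \<tau> - q t / 2) * (norm (u t))\<^sup>2
    - \<tau> * (norm (h t))\<^sup>2 - k * \<kappa>\<^sup>2 * (norm (m t))\<^sup>2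
    + k * (2 * N\<^sup>2 * \<gamma> / \<tau>) * ((norm (u t))\<^sup>2 + \<tau>\<^sup>2 * (norm (h t))\<^sup>2)
    - \<tau> * (h t \<bullet> xs) + \<psi> k t * (1 + Q t)"
proof -
  have e: "e t > 0" using e_pos[OF t] .
  have 1: "(dG (x t) \<bullet> u t - V t \<bullet> g t) / (e t)\<^sup>2 \<le> - \<tau> * (G (x t) / (e t)\<^sup>2)"
    using divide_right_mono[OF gradient_terms[OF t small], of "(e t)\<^sup>2"] by simp
  have 2: "\<tau> * (q t - q\<^sub>0) / 2 * (u t \<bullet> h t) \<le> \<tau> * \<bar>q t - q\<^sub>0\<bar> / 2 * (1 + Q t)"
  proof -
    have uh: "\<bar>u t \<bullet> h t\<bar> \<le> 1 + Q t"
      using Cauchy_Schwarz_ineq2[of "u t" "h t"] Q_bounds(1)[of t] by linarith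
    have "\<tau> * (q t - q\<^sub>0) / 2 * (u t \<bullet> h t) \<le> \<bar>\<tau> * (q t - q\<^sub>0) / 2\<bar> * \<bar>u t \<bullet> h t\<bar>"
      by (metis abs_ge_self abs_mult)
    also have "\<dots> \<le> \<bar>\<tau> * (q t - q\<^sub>0) / 2\<bar> * (1 + Q t)" by (intro mult_left_mono uh) auto
    also have "\<bar>\<tau> * (q t - q\<^sub>0) / 2\<bar> = \<tau> * \<bar>q t - q\<^sub>0\<bar> / 2" using \<tau>_pos by (simp add: abs_mult)
    finally show ?thesis .
  qed
  have E: "(e t)\<^sup>2 \<ge> 0" by simp
  have 3: "- q t * (e t)\<^sup>2 * (V t \<bullet> p t) \<le> N * ((e t)\<^sup>2 * (\<bar>q t\<bar> * (1 + \<tau>))) * (1 + Q t)"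
  proof -
    have "- q t * (e t)\<^sup>2 * (V t \<bullet> p t) \<le> \<bar>- q t * (e t)\<^sup>2 * (V t \<bullet> p t)\<bar>" by (rule abs_ge_self)
    also have "\<dots> = \<bar>q t\<bar> * (e t)\<^sup>2 * \<bar>V t \<bullet> p t\<bar>" by (simp add: abs_mult)
    also have "\<dots> \<le> \<bar>q t\<bar> * (e t)\<^sup>2 * (N * (1 + \<tau>) * (1 + Q t))"
      using N_pos \<tau>_pos by (intro mult_left_mono order_trans[OF V_p]) auto
    finally show ?thesis by (simp add: mult_ac)
  qed
  have 4: "(e t)\<^sup>2 * ((\<tau> - \<delta> + q t / 2) * (u t \<bullet> p t) - h t \<bullet> p t - xs \<bullet> p t)
      \<le> N * ((e t)\<^sup>2 * (\<bar>\<tau> - \<delta> + q t / 2\<bar> + 1 + norm xs)) * (1 + Q t)"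
  proof -
    have a: "\<bar>u t \<bullet> p t\<bar> \<le> N * (1 + Q t)" "\<bar>h t \<bullet> p t\<bar> \<le> N * (1 + Q t)"
      using Q_bounds(2,3)[of t] N_pos by (auto intro!: order_trans[OF inner_p] mult_left_mono)
    have b: "\<bar>xs \<bullet> p t\<bar> \<le> norm xs * (N * (1 + Q t))"
      using N_pos mult_left_mono[OF Q_bounds(4)[of t], of "N * norm xs"]
      by (intro order_trans[OF inner_p]) (simp add: mult_ac)
    have "(\<tau> - \<delta> + q t / 2) * (u t \<bullet> p t) \<le> \<bar>\<tau> - \<delta> + q t / 2\<bar> * \<bar>u t \<bullet> p t\<bar>"
      by (metis abs_ge_self abs_mult)
    also have "\<dots> \<le> \<bar>\<tau> - \<delta> + q t / 2\<bar> * (N * (1 + Q t))" by (intro mult_left_mono a) auto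
    finally have "(\<tau> - \<delta> + q t / 2) * (u t \<bullet> p t) - h t \<bullet> p t - xs \<bullet> p t
      \<le> \<bar>\<tau> - \<delta> + q t / 2\<bar> * (N * (1 + Q t)) + N * (1 + Q t) + norm xs * (N * (1 + Q t))"
      using a b by linarith
    from mult_left_mono[OF this E] show ?thesis by (simp add: algebra_simps)
  qed
  have 5: "- (g t \<bullet> p t) \<le> N * (e t * (2 * sqrt \<Lambda> + \<Lambda> * B)) * (1 + Q t)"
  proof -
    have "0 \<le> N * (e t * (2 * sqrt \<Lambda> + \<Lambda> * B))"
      using N_pos e \<Lambda> \<beta>[OF t] by (intro mult_nonneg_nonneg add_nonneg_nonneg) auto
    then show ?thesis using g_p[OF t] by (simp add: algebra_simps)
  qed
  have 6: "- (p t \<bullet> p t) \<le> - \<kappa>\<^sup>2 * (norm (m t))\<^sup>2"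
    using power_mono[OF m_coercive[OF t], of 2] \<kappa>
    by (simp add: p_def power2_norm_eq_inner[symmetric] power_mult_distrib)
  have 7: "\<gamma> / \<tau> * (A (V t) \<bullet> A (V t)) \<le> 2 * N\<^sup>2 * \<gamma> / \<tau> * ((norm (u t))\<^sup>2 + \<tau>\<^sup>2 * (norm (h t))\<^sup>2)"
  proof -
    have "A (V t) \<bullet> A (V t) \<le> N\<^sup>2 * (norm (V t))\<^sup>2"
      using power_mono[OF norm_A[of "V t"], of 2] by (simp add: power2_norm_eq_inner[symmetric] power_mult_distrib)
    also have "\<dots> \<le> N\<^sup>2 * (2 * ((norm (u t))\<^sup>2 + \<tau>\<^sup>2 * (norm (h t))\<^sup>2))"
      by (intro mult_left_mono V_sq) auto
    finally have "A (V t) \<bullet> A (V t) \<le> 2 * N\<^sup>2 * ((norm (u t))\<^sup>2 + \<tau>\<^sup>2 * (norm (h t))\<^sup>2)"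
      by (simp only: mult.assoc mult.left_commute)
    from mult_left_mono[OF this, of "\<gamma> / \<tau>"] show ?thesis using \<gamma> \<tau>_pos by (simp add: mult_ac)
  qed
  define R where "R = - q t * (e t)\<^sup>2 * (V t \<bullet> p t)
         + (e t)\<^sup>2 * ((\<tau> - \<delta> + q t / 2) * (u t \<bullet> p t) - h t \<bullet> p t - xs \<bullet> p t)
         - g t \<bullet> p t - p t \<bullet> p t + \<gamma> / \<tau> * (A (V t) \<bullet> A (V t))"
  have "R \<le> N * ((e t)\<^sup>2 * (\<bar>q t\<bar> * (1 + \<tau>))) * (1 + Q t)
      + N * ((e t)\<^sup>2 * (\<bar>\<tau> - \<delta> + q t / 2\<bar> + 1 + norm xs)) * (1 + Q t)
      + N * (e t * (2 * sqrt \<Lambda> + \<Lambda> * B)) * (1 + Q t) - \<kappa>\<^sup>2 * (norm (m t))\<^sup>2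
      + 2 * N\<^sup>2 * \<gamma> / \<tau> * ((norm (u t))\<^sup>2 + \<tau>\<^sup>2 * (norm (h t))\<^sup>2)"
    using 3 4 5 6 7 unfolding R_def by linarith
  from mult_left_mono[OF this k]
  have "k * R \<le> (\<psi> k t - \<tau> * \<bar>q t - q\<^sub>0\<bar> / 2) * (1 + Q t) - k * \<kappa>\<^sup>2 * (norm (m t))\<^sup>2
      + k * (2 * N\<^sup>2 * \<gamma> / \<tau>) * ((norm (u t))\<^sup>2 + \<tau>\<^sup>2 * (norm (h t))\<^sup>2)"
    by (simp only: \<psi>_def distrib_left distrib_right right_diff_distrib left_diff_distrib mult_ac)
  then have 8: "k * R \<le> \<psi> k t * (1 + Q t) - \<tau> * \<bar>q t - q\<^sub>0\<bar> / 2 * (1 + Q t) - k * \<kappa>\<^sup>2 * (norm (m t))\<^sup>2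
      + k * (2 * N\<^sup>2 * \<gamma> / \<tau>) * ((norm (u t))\<^sup>2 + \<tau>\<^sup>2 * (norm (h t))\<^sup>2)"
    by (simp only: left_diff_distrib)
  have "- (\<tau> - q t) * (G (x t) / (e t)\<^sup>2) = q t * (G (x t) / (e t)\<^sup>2) + - \<tau> * (G (x t) / (e t)\<^sup>2)"
    by (simp only: distrib_right[symmetric]) simp
  then show ?thesis
    using 1 2 8 unfolding DW_def R_def[symmetric] power2_norm_eq_inner by linarith
qed

text \<open>A small positive \<open>k\<close> works: the price of the cross term then uses at most
  half of the dissipation in \<open>u\<close> and \<open>h\<close>, while dissipation in
  \<open>m\<close> is still gained.\<close>

lemma energy_estimate:
  obtains a c C k where "a > 0" "c > 0" "C > 0"
    "\<forall>\<^sub>F t in at_top. c * Q t + xs \<bullet> h t \<le> W k t"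
    "\<forall>\<^sub>F t in at_top. W k t \<le> C * Q t + xs \<bullet> h t"
    "\<forall>\<eta>>0. \<forall>\<^sub>F t in at_top. DW k t \<le> - a * Q t - \<tau> * (xs \<bullet> h t) + \<eta>"
proof -
  \<comment> \<open>The limiting coefficients of the gap and of the velocity are halved, so that the
    actual ones exceed \<open>a0\<close> at late times.\<close>
  define a0 where "a0 = min ((\<tau> - q\<^sub>0) / 2) (min ((\<delta> - \<tau> - q\<^sub>0 / 2) / 2) \<tau>)"
  have a0: "a0 > 0" using \<tau> \<delta> \<tau>_pos by (simp add: a0_def)
  \<comment> \<open>Solves \<open>k * (2 * N\<^sup>2 * \<gamma> / \<tau>) * (1 + \<tau>\<^sup>2) =
    a0 / 2\<close>, which covers the price in both squares.\<close>
  define k where "k = a0 / 2 / ((2 * N\<^sup>2 * \<gamma> / \<tau>) * (1 + \<tau>\<^sup>2))"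
  have c0: "(2 * N\<^sup>2 * \<gamma> / \<tau>) * (1 + \<tau>\<^sup>2) > 0"
    using N_pos \<gamma> \<tau>_pos by (intro mult_pos_pos divide_pos_pos) (auto simp: add_pos_nonneg)
  have k: "k > 0" unfolding k_def by (intro divide_pos_pos c0) (use a0 in auto)
  have cancel: "z / y * y = z" if "y > 0" for z y :: real using that by simp
  have "k * (2 * N\<^sup>2 * \<gamma> / \<tau>) * (1 + \<tau>\<^sup>2) = a0 / 2"
    unfolding mult.assoc[of k] unfolding k_def by (rule cancel[OF c0])
  moreover have kN: "k * (2 * N\<^sup>2 * \<gamma> / \<tau>) \<ge> 0" using k \<gamma> \<tau>_pos by simp
  ultimately have kN1: "k * (2 * N\<^sup>2 * \<gamma> / \<tau>) \<le> a0 / 2"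
    and kN2: "k * (2 * N\<^sup>2 * \<gamma> / \<tau>) * \<tau>\<^sup>2 \<le> a0 / 2"
    using mult_nonneg_nonneg[OF kN zero_le_power2[of \<tau>]] by (auto simp: distrib_left)
  \<comment> \<open>The net dissipation is at least \<open>2 * a * Q t\<close>: one copy of
    \<open>a * Q t\<close> absorbs \<open>\<psi> k t * Q t\<close>, the other remains.\<close>
  define a where "a = min (a0 / 2) (k * \<kappa>\<^sup>2) / 2"
  have a: "a > 0" using a0 k \<kappa> by (simp add: a_def)
  have a_le: "2 * a \<le> a0 / 2" "2 * a \<le> k * \<kappa>\<^sup>2" by (auto simp: a_def)
  have ev_a0: "\<forall>\<^sub>F t in at_top. \<tau> - q t \<ge> a0 \<and> \<delta> - \<tau> - q t / 2 \<ge> a0"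
  proof -
    have "((\<lambda>t. \<tau> - q t) \<longlongrightarrow> \<tau> - q\<^sub>0) at_top" "((\<lambda>t. \<delta> - \<tau> - q t / 2) \<longlongrightarrow> \<delta> - \<tau> - q\<^sub>0 / 2) at_top"
      by (intro tendsto_intros q_lim; simp)+
    moreover have "a0 < \<tau> - q\<^sub>0" "a0 < \<delta> - \<tau> - q\<^sub>0 / 2" using \<tau> \<delta> by (auto simp: a0_def min_def)
    ultimately have "\<forall>\<^sub>F t in at_top. a0 < \<tau> - q t" "\<forall>\<^sub>F t in at_top. a0 < \<delta> - \<tau> - q t / 2"
      by (auto intro: order_tendstoD(1))
    then show ?thesis by eventually_elim auto
  qed
  have ev_small: "\<forall>\<^sub>F t in at_top. \<tau> * B * e t \<le> 1"
  proof -
    have "((\<lambda>t. \<tau> * B * e t) \<longlongrightarrow> \<tau> * B * 0) at_top" by (intro tendsto_intros e_lim)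
    then have "\<forall>\<^sub>F t in at_top. \<tau> * B * e t < 1" by (intro order_tendstoD(2)) auto
    then show ?thesis by eventually_elim simp
  qed
  have est: "\<forall>\<^sub>F t in at_top. DW k t \<le> - a * Q t - \<tau> * (xs \<bullet> h t) + \<eta>" if \<eta>: "\<eta> > 0" for \<eta>
  proof -
    have "\<forall>\<^sub>F t in at_top. \<psi> k t < min a \<eta>"
      using a \<eta> by (intro order_tendstoD(2)[OF \<psi>_lim]) auto
    then show ?thesis using ev_a0 ev_small eventually_ge_at_top[of T]
    proof eventually_elim
      case (elim t)
      define X where "X = G (x t) / (e t)\<^sup>2"
      define nu where "nu = (norm (u t))\<^sup>2"
      define nh where "nh = (norm (h t))\<^sup>2"
      define nm where "nm = (norm (m t))\<^sup>2"
      have nn: "X \<ge> 0" "nu \<ge> 0" "nh \<ge> 0" "nm \<ge> 0"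
        using Q_bounds(6) by (auto simp: X_def nu_def nh_def nm_def)
      have Q: "Q t = X + nu + nh + nm" by (simp add: Q_def X_def nu_def nh_def nm_def)
      have D: "DW k t \<le> - (\<tau> - q t) * X - (\<delta> - \<tau> - q t / 2) * nu - \<tau> * nh - k * \<kappa>\<^sup>2 * nm
        + k * (2 * N\<^sup>2 * \<gamma> / \<tau>) * (nu + \<tau>\<^sup>2 * nh) - \<tau> * (h t \<bullet> xs) + \<psi> k t * (1 + Q t)"
        using DW_le[of t k] elim k by (simp add: X_def nu_def nh_def nm_def)
      have "\<tau> \<ge> a0" by (simp add: a0_def)
      have 1: "a0 * X \<le> (\<tau> - q t) * X" "a0 * nu \<le> (\<delta> - \<tau> - q t / 2) * nu" "a0 * nh \<le> \<tau> * nh"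
        "2 * a * nm \<le> k * \<kappa>\<^sup>2 * nm" "2 * a * X \<le> a0 / 2 * X" "2 * a * nu \<le> a0 / 2 * nu"
        "2 * a * nh \<le> a0 / 2 * nh" "k * (2 * N\<^sup>2 * \<gamma> / \<tau>) * nu \<le> a0 / 2 * nu"
        "k * (2 * N\<^sup>2 * \<gamma> / \<tau>) * \<tau>\<^sup>2 * nh \<le> a0 / 2 * nh"
        using nn elim(2) \<open>\<tau> \<ge> a0\<close> a_le kN1 kN2 by (intro mult_right_mono; simp)+
      have 2: "0 \<le> a0 * X" using nn a0 by simp
      have 3: "\<psi> k t * (1 + Q t) \<le> a * Q t + \<eta>"
        using elim(1) mult_right_mono[of "\<psi> k t" a "Q t"] Q_bounds(5)[of t] by (simp add: distrib_left)
      have 4: "k * (2 * N\<^sup>2 * \<gamma> / \<tau>) * (nu + \<tau>\<^sup>2 * nh)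
          = k * (2 * N\<^sup>2 * \<gamma> / \<tau>) * nu + k * (2 * N\<^sup>2 * \<gamma> / \<tau>) * \<tau>\<^sup>2 * nh"
        by (simp only: distrib_left mult.assoc)
      have 5: "2 * a * X + 2 * a * nu + 2 * a * nh + 2 * a * nm = 2 * (a * Q t)"
        by (simp add: Q algebra_simps)
      show ?case
        using D 1 2 3 5 unfolding 4 inner_commute[of xs] by linarith
    qed
  qed
  \<comment> \<open>Only the fraction \<open>\<theta>\<close> of the square of \<open>V\<close> is
    used to recover that of \<open>u\<close>. By
    \<open>\<theta> * \<tau>\<^sup>2 \<le> 1 / 2\<close> this costs at most a quarter of the square
    of \<open>h\<close>, of which \<open>(\<xi> + 1) / 2\<close> provides at least half.\<close>
  define \<theta> where "\<theta> = 1 / (1 + 2 * \<tau>\<^sup>2)"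
  have \<theta>: "\<theta> > 0" "\<theta> \<le> 1" "\<theta> * \<tau>\<^sup>2 \<le> 1 / 2"
  proof -
    define D where "D = 1 + 2 * \<tau>\<^sup>2"
    have "D \<ge> 1" by (simp add: D_def)
    then show "\<theta> > 0" "\<theta> \<le> 1" "\<theta> * \<tau>\<^sup>2 \<le> 1 / 2"
      unfolding \<theta>_def D_def[symmetric] by (simp_all add: field_simps) (simp add: D_def)
  qed
  \<comment> \<open>The division by 2 leaves one copy of \<open>c * Q t\<close> after the cross term
    \<open>Z\<close> has consumed another.\<close>
  define c where "c = min (\<theta> / 4) (\<tau> / (2 * \<gamma>)) / 2"
  have c: "c > 0" using \<theta> \<tau>_pos \<gamma> by (simp add: c_def)
  have c_le: "2 * c \<le> \<theta> / 4" "2 * c \<le> \<tau> / (2 * \<gamma>)" by (auto simp: c_def)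
  define C where "C = c + 1 + \<tau>\<^sup>2 + \<tau> / (2 * \<gamma>) + (\<xi> + 1) / 2"
  have C: "C > 0" using c \<tau>_pos \<gamma> \<xi>_nonneg by (simp add: C_def add_pos_nonneg)
  have "\<forall>\<^sub>F t in at_top. k * ((e t)\<^sup>2 * (N * (1 + \<tau>))) < c"
  proof -
    have "((\<lambda>t. k * ((e t)\<^sup>2 * (N * (1 + \<tau>)))) \<longlongrightarrow> k * (0\<^sup>2 * (N * (1 + \<tau>)))) at_top"
      by (intro tendsto_intros e_lim)
    then show ?thesis using c by (intro order_tendstoD(2)) auto
  qed
  then have W_bds: "\<forall>\<^sub>F t in at_top. c * Q t + xs \<bullet> h t \<le> W k t \<and> W k t \<le> C * Q t + xs \<bullet> h t"
  proof eventually_elim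
    case (elim t)
    define X where "X = G (x t) / (e t)\<^sup>2"
    define nu where "nu = (norm (u t))\<^sup>2"
    define nh where "nh = (norm (h t))\<^sup>2"
    define nm where "nm = (norm (m t))\<^sup>2"
    define nV where "nV = (norm (V t))\<^sup>2"
    define Z where "Z = k * ((e t)\<^sup>2 * (V t \<bullet> p t))"
    have nn: "X \<ge> 0" "nu \<ge> 0" "nh \<ge> 0" "nm \<ge> 0" "nV \<ge> 0"
      using Q_bounds(6) by (auto simp: X_def nu_def nh_def nm_def nV_def)
    have Q: "Q t = X + nu + nh + nm" by (simp add: Q_def X_def nu_def nh_def nm_def)
    have W: "W k t = X + nV / 2 + \<tau> / (2 * \<gamma>) * nm + (\<xi> + 1) / 2 * nh + xs \<bullet> h t + Z"
      by (simp add: W_def X_def nV_def nm_def nh_def Z_def power2_norm_eq_inner)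
    have "\<bar>Z\<bar> = k * ((e t)\<^sup>2 * \<bar>V t \<bullet> p t\<bar>)" using k by (simp add: Z_def abs_mult)
    also have "\<dots> \<le> k * ((e t)\<^sup>2 * (N * (1 + \<tau>) * Q t))"
      by (intro mult_left_mono V_p) (use k in auto)
    also have "\<dots> = k * ((e t)\<^sup>2 * (N * (1 + \<tau>))) * Q t" by simp
    also have "\<dots> \<le> c * Q t" using elim Q_bounds(5) by (intro mult_right_mono) auto
    finally have Z: "\<bar>Z\<bar> \<le> c * Q t" .
    have V: "nV \<le> 2 * (nu + \<tau>\<^sup>2 * nh)" "nu \<le> 2 * (nV + \<tau>\<^sup>2 * nh)"
      using V_sq[of t] u_sq[of t] by (auto simp: nV_def nu_def nh_def)
    have "2 * c \<le> 1" "2 * c \<le> 1 / 4" using c_le \<theta> by auto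
    then have 1: "2 * c * X \<le> 1 * X" "2 * c * nu \<le> \<theta> / 4 * nu"
        "2 * c * nm \<le> \<tau> / (2 * \<gamma>) * nm" "2 * c * nh \<le> 1 / 4 * nh"
      using c_le nn by (intro mult_right_mono; simp)+
    have 2: "\<theta> * nu \<le> \<theta> * (2 * (nV + \<tau>\<^sup>2 * nh))" using V \<theta> by (intro mult_left_mono) auto
    have 3: "\<theta> * nV \<le> nV" using \<theta> nn by (simp add: mult_left_le_one_le)
    have 4: "\<theta> * \<tau>\<^sup>2 * nh \<le> 1 / 2 * nh" using \<theta> nn by (intro mult_right_mono)
    have 5: "1 / 2 * nh \<le> (\<xi> + 1) / 2 * nh" using \<xi>_nonneg nn by (intro mult_right_mono) auto
    have 6: "2 * c * X + 2 * c * nu + 2 * c * nh + 2 * c * nm = 2 * (c * Q t)"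
      by (simp add: Q algebra_simps)
    have 7: "\<theta> * (2 * (nV + \<tau>\<^sup>2 * nh)) = 2 * (\<theta> * nV) + 2 * (\<theta> * \<tau>\<^sup>2 * nh)"
      by (simp add: algebra_simps)
    have lower: "c * Q t + xs \<bullet> h t \<le> W k t"
      using W Z 1 2 3 4 5 6 unfolding 7 by linarith
    have "nh \<le> Q t" "nm \<le> Q t" using nn unfolding Q by auto
    then have 8: "\<tau> / (2 * \<gamma>) * nm + (\<xi> + 1) / 2 * nh \<le> \<tau> / (2 * \<gamma>) * Q t + (\<xi> + 1) / 2 * Q t"
      using \<tau>_pos \<gamma> \<xi>_nonneg by (intro add_mono mult_left_mono) auto
    have 9: "X + nu + \<tau>\<^sup>2 * nh \<le> Q t + \<tau>\<^sup>2 * Q t"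
      using nn \<open>nh \<le> Q t\<close> by (intro add_mono mult_left_mono) (auto simp: Q)
    have "W k t \<le> (X + nu + \<tau>\<^sup>2 * nh) + (\<tau> / (2 * \<gamma>) * nm + (\<xi> + 1) / 2 * nh) + xs \<bullet> h t + c * Q t"
      using V(1) abs_le_D1[OF Z] unfolding W by simp
    also have "\<dots> \<le> (Q t + \<tau>\<^sup>2 * Q t) + (\<tau> / (2 * \<gamma>) * Q t + (\<xi> + 1) / 2 * Q t) + xs \<bullet> h t + c * Q t"
      by (intro add_mono 8 9 order_refl)
    also have "\<dots> = C * Q t + xs \<bullet> h t"
      by (simp add: C_def distrib_right)
    finally have "W k t \<le> C * Q t + xs \<bullet> h t" .
    with lower show ?case by blast
  qed
  show ?thesis
    by (rule that[OF a c C]) (use W_bds est in \<open>auto elim: eventually_mono\<close>)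
qed

text \<open>As long as the sign of \<open>xs \<bullet> h t\<close> is unknown, Young's inequality
  splits it into a small multiple of \<open>Q t\<close> and a constant, so the decay yields
  boundedness only. The compactness argument for the sign rests on this.\<close>

lemma Q_bounded: "\<exists>M. \<forall>\<^sub>F t in at_top. Q t \<le> M"
proof -
  obtain a c C k where kc: "a > 0" "c > 0" "C > 0"
    and lo: "\<forall>\<^sub>F t in at_top. c * Q t + xs \<bullet> h t \<le> W k t"
    and up: "\<forall>\<^sub>F t in at_top. W k t \<le> C * Q t + xs \<bullet> h t"
    and est: "\<forall>\<eta>>0. \<forall>\<^sub>F t in at_top. DW k t \<le> - a * Q t - \<tau> * (xs \<bullet> h t) + \<eta>"
    by (rule energy_estimate)
  have young: "\<bar>z * (xs \<bullet> h t)\<bar> \<le> s / 2 * Q t + (z * norm xs)\<^sup>2 / (2 * s)" if s: "s > 0" for s z t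
  proof -
    have "0 \<le> (s * norm (h t) - \<bar>z\<bar> * norm xs)\<^sup>2" by simp
    then have "\<bar>z\<bar> * norm xs * norm (h t) \<le> s / 2 * (norm (h t))\<^sup>2 + (z * norm xs)\<^sup>2 / (2 * s)"
      using s by (simp add: power2_diff power_mult_distrib field_simps power2_eq_square)
    moreover have "\<bar>z * (xs \<bullet> h t)\<bar> \<le> \<bar>z\<bar> * norm xs * norm (h t)"
      unfolding abs_mult mult.assoc by (intro mult_left_mono Cauchy_Schwarz_ineq2) auto
    moreover have "s / 2 * (norm (h t))\<^sup>2 \<le> s / 2 * Q t"
      using s Q_bounds(7) by (intro mult_left_mono) auto
    ultimately show ?thesis by linarith
  qed
  \<comment> \<open>Since \<open>W k t\<close> is at most \<open>(C + 1) * Q t\<close> plus a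
    constant, this rate uses half of the dissipation \<open>a * Q t\<close>; the other half absorbs
    \<open>\<tau> * (xs \<bullet> h t)\<close>.\<close>
  define r where "r = a / (2 * (C + 1))"
  have r: "r > 0" using kc by (simp add: r_def)
  define M1 where "M1 = (\<tau> * norm xs)\<^sup>2 / (2 * a) + 1 + r * ((1 * norm xs)\<^sup>2 / (2 * 2))"
  have "\<forall>\<^sub>F t in at_top. W k t < (M1 + 1) / r"
  proof (rule eventually_less_if_linear_decay[OF r _ S_deriv S_lim])
    show "M1 < r * ((M1 + 1) / r)" using r by simp
    show "\<forall>\<^sub>F t in at_top. \<exists>d. (W k has_real_derivative d) (at t) \<and> d \<le> e t * (M1 - r * W k t)"
      using up est[rule_format, OF zero_less_one] eventually_ge_at_top[of T]
    proof eventually_elim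
      case (elim t)
      have "W k t \<le> (C + 1) * Q t + (1 * norm xs)\<^sup>2 / (2 * 2)"
        using elim(1) young[of 2 1 t] by (simp add: distrib_right)
      then have "r * W k t \<le> r * ((C + 1) * Q t + (1 * norm xs)\<^sup>2 / (2 * 2))"
        using r by (intro mult_left_mono) auto
      also have "\<dots> = a / 2 * Q t + r * ((1 * norm xs)\<^sup>2 / (2 * 2))"
        using kc by (simp add: r_def field_simps)
      finally have "r * W k t \<le> a / 2 * Q t + r * ((1 * norm xs)\<^sup>2 / (2 * 2))" .
      then have "DW k t \<le> M1 - r * W k t"
        using elim(2) young[OF kc(1), of \<tau> t] unfolding M1_def by simp
      then show ?case
        using W_deriv[OF elim(3), of k] e_pos[OF elim(3)] by (meson mult_left_mono less_imp_le)
    qed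
  qed
  then have "\<forall>\<^sub>F t in at_top. Q t \<le> ((M1 + 1) / r + (1 * norm xs)\<^sup>2 / (2 * c)) / (c / 2)"
    using lo
  proof eventually_elim
    case (elim t)
    then have "c / 2 * Q t \<le> (M1 + 1) / r + (1 * norm xs)\<^sup>2 / (2 * c)"
      using abs_le_D2[OF young[OF kc(2), of 1 t]] unfolding mult_1 by linarith
    then show ?case using kc by (subst pos_le_divide_eq) (auto simp: mult.commute)
  qed
  then show ?thesis by blast
qed

section \<open>Convergence of the rescaled flow\<close>

lemma h_m_bounded:
  obtains M where "M > 0" "\<forall>\<^sub>F t in at_top. norm (h t) \<le> M" "\<forall>\<^sub>F t in at_top. norm (m t) \<le> M"
    "\<forall>\<^sub>F t in at_top. G (x t) \<le> M * (e t)\<^sup>2"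
proof -
  obtain M where M: "\<forall>\<^sub>F t in at_top. Q t \<le> M" using Q_bounded by blast
  have bd: "\<forall>\<^sub>F t in at_top. norm (h t) \<le> 1 + \<bar>M\<bar> \<and> norm (m t) \<le> 1 + \<bar>M\<bar> \<and> G (x t) \<le> (1 + \<bar>M\<bar>) * (e t)\<^sup>2"
    using M eventually_ge_at_top[of T]
  proof eventually_elim
    case (elim t)
    have "norm (h t) \<le> 1 + Q t"
      using prod_le_sum_sq[of 1 "norm (h t)"] Q_bounds(7)[of t] by simp
    moreover have "G (x t) / (e t)\<^sup>2 \<le> 1 + \<bar>M\<bar>"
      using Q_bounds(10)[of t] elim by simp
    then have "G (x t) \<le> (1 + \<bar>M\<bar>) * (e t)\<^sup>2" using e_pos[OF elim(2)] by (simp add: divide_le_eq)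
    ultimately show ?case using Q_bounds(4)[of t] elim by auto
  qed
  show ?thesis
    by (rule that[of "1 + \<bar>M\<bar>"]) (use bd in \<open>auto elim: eventually_mono\<close>)
qed

section \<open>Decay of the constraint violation\<close>

lemma e_sq_m_lim: "((\<lambda>t. (e t)\<^sup>2 *\<^sub>R m t) \<longlongrightarrow> 0) at_top"
proof -
  obtain M where M: "\<forall>\<^sub>F t in at_top. norm (m t) \<le> M" by (rule h_m_bounded)
  have "((\<lambda>t. (e t)\<^sup>2 * M) \<longlongrightarrow> 0\<^sup>2 * M) at_top" by (intro tendsto_intros e_lim)
  moreover have "\<forall>\<^sub>F t in at_top. norm ((e t)\<^sup>2 *\<^sub>R m t) \<le> (e t)\<^sup>2 * M"
    using M by eventually_elim (simp add: mult_left_mono)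
  ultimately show ?thesis by (auto intro: Lim_null_comparison)
qed

text \<open>The subtraction eliminates the velocity: \<open>A (u t)\<close> drives
  \<open>A (h t)\<close> and, through the multiplier equation, also
  \<open>(e t)\<^sup>2 *\<^sub>R m t\<close>; the factor \<open>\<tau> / \<gamma>\<close> equates
  the two contributions.\<close>

definition \<zeta> :: "real \<Rightarrow> 'b" where "\<zeta> t = A (h t) - (\<tau> / \<gamma>) *\<^sub>R (e t)\<^sup>2 *\<^sub>R m t"

lemma \<zeta>_deriv:
  assumes t: "t \<ge> T"
  shows "(\<zeta> has_vector_derivative
    e t *\<^sub>R ((\<tau> / \<gamma> * (q t - \<tau>)) *\<^sub>R (e t)\<^sup>2 *\<^sub>R m t - \<tau> *\<^sub>R \<zeta> t)) (at t)"
proof -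
  have bl: "bounded_linear A" using lin by (simp add: linear_conv_bounded_linear)
  have de: "((\<lambda>t. (e t)\<^sup>2) has_real_derivative - q t * e t * (e t)\<^sup>2) (at t)"
    by (auto intro!: derivative_eq_intros e_deriv[OF t])
  have "(\<zeta> has_vector_derivative A (e t *\<^sub>R u t) - (\<tau> / \<gamma>) *\<^sub>R
     ((e t)\<^sup>2 *\<^sub>R (e t *\<^sub>R (\<gamma> / (\<tau> * (e t)\<^sup>2)) *\<^sub>R A (u t + \<tau> *\<^sub>R (x t - xs)))
       + (- q t * e t * (e t)\<^sup>2) *\<^sub>R m t)) (at t)"
    unfolding \<zeta>_def
    by (intro has_vector_derivative_diff bounded_linear.has_vector_derivative[OF bl h_deriv[OF t]]
        bounded_linear.has_vector_derivative[OF bounded_linear_scaleR_right]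
        has_vector_derivative_scaleR de m_deriv[OF t])
  then show ?thesis
  proof (rule back_subst[where P = "\<lambda>d. (\<zeta> has_vector_derivative d) (at t)"], goal_cases)
    case 1
    have "(\<tau> / \<gamma> * ((e t)\<^sup>2 * (e t * (\<gamma> / (\<tau> * (e t)\<^sup>2))))) = e t"
      using e_pos[OF t] \<gamma> \<tau>_pos by simp
    then have "(\<tau> / \<gamma>) *\<^sub>R ((e t)\<^sup>2 *\<^sub>R (e t *\<^sub>R (\<gamma> / (\<tau> * (e t)\<^sup>2)) *\<^sub>R A (u t + \<tau> *\<^sub>R (x t - xs))))
        = e t *\<^sub>R A (u t) + e t *\<^sub>R \<tau> *\<^sub>R A (h t)"
      by (simp only: scaleR_scaleR mult.assoc)
        (simp add: h_def linear_add[OF lin] linear_cmul[OF lin] scaleR_add_right)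
    then show ?case
      by (simp only: scaleR_add_right) (simp add: \<zeta>_def linear_cmul[OF lin] algebra_simps)
  qed
qed

text \<open>Boundedness of \<open>m\<close> suffices at this stage: the forcing in the equation for
  \<open>\<zeta>\<close> is a bounded multiple of
  \<open>(e t)\<^sup>2 *\<^sub>R m t\<close>.\<close>

lemma A_h_lim: "((\<lambda>t. A (h t)) \<longlongrightarrow> 0) at_top"
proof -
  have "(\<zeta> \<longlongrightarrow> 0) at_top"
  proof (rule tendsto_zero_if_linear_decay[OF \<tau>_pos S_deriv S_lim])
    show "\<forall>\<^sub>F t in at_top. 0 < e t"
      using eventually_ge_at_top[of T] by eventually_elim (rule e_pos)
    show "\<forall>\<^sub>F t in at_top. (\<zeta> has_vector_derivative
        e t *\<^sub>R ((\<tau> / \<gamma> * (q t - \<tau>)) *\<^sub>R (e t)\<^sup>2 *\<^sub>R m t - \<tau> *\<^sub>R \<zeta> t)) (at t)"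
      using eventually_ge_at_top[of T] by eventually_elim (rule \<zeta>_deriv)
    have "((\<lambda>t. (\<tau> / \<gamma> * (q t - \<tau>)) *\<^sub>R (e t)\<^sup>2 *\<^sub>R m t) \<longlongrightarrow> (\<tau> / \<gamma> * (q\<^sub>0 - \<tau>)) *\<^sub>R 0) at_top"
      by (intro tendsto_intros q_lim e_sq_m_lim)
    then show "((\<lambda>t. (\<tau> / \<gamma> * (q t - \<tau>)) *\<^sub>R (e t)\<^sup>2 *\<^sub>R m t) \<longlongrightarrow> 0) at_top" by simp
  qed auto
  then have "((\<lambda>t. \<zeta> t + (\<tau> / \<gamma>) *\<^sub>R (e t)\<^sup>2 *\<^sub>R m t) \<longlongrightarrow> 0 + (\<tau> / \<gamma>) *\<^sub>R 0) at_top"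
    by (intro tendsto_intros e_sq_m_lim)
  then show ?thesis by (simp add: \<zeta>_def)
qed

text \<open>Division by \<open>(e t)\<^sup>2\<close> lowers the damping from \<open>\<tau>\<close>
  to \<open>\<tau> - q t\<close>, still positive in the limit by \<open>\<tau> > q\<^sub>0\<close>.
  The forcing becomes a bounded multiple of \<open>m\<close> itself, whence the assumption.\<close>

lemma A_h_div_lim:
  assumes m: "(m \<longlongrightarrow> 0) at_top"
  shows "((\<lambda>t. (1 / (e t)\<^sup>2) *\<^sub>R A (h t)) \<longlongrightarrow> 0) at_top"
proof -
  define Y where "Y = (\<lambda>t. (1 / (e t)\<^sup>2) *\<^sub>R \<zeta> t)"
  have "(Y \<longlongrightarrow> 0) at_top"
  proof (rule tendsto_zero_if_linear_decay[OF _ S_deriv S_lim])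
    show "(\<tau> - q\<^sub>0) / 2 > 0" using \<tau> by simp
    show "\<forall>\<^sub>F t in at_top. 0 < e t"
      using eventually_ge_at_top[of T] by eventually_elim (rule e_pos)
    show "\<forall>\<^sub>F t in at_top. (Y has_vector_derivative
        e t *\<^sub>R ((\<tau> / \<gamma> * (q t - \<tau>)) *\<^sub>R m t - (\<tau> - q t) *\<^sub>R Y t)) (at t)"
      using eventually_ge_at_top[of T]
    proof eventually_elim
      case (elim t)
      have e: "e t > 0" by (rule e_pos[OF elim])
      have "((\<lambda>t. 1 / (e t)\<^sup>2) has_real_derivative q t * e t / (e t)\<^sup>2) (at t)"
        using e by (auto intro!: derivative_eq_intros e_deriv[OF elim] simp: power2_eq_square)
      from has_vector_derivative_scaleR[OF this \<zeta>_deriv[OF elim]] show ?case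
        unfolding Y_def[symmetric]
        by (rule back_subst[where P = "\<lambda>d. (Y has_vector_derivative d) (at t)"])
          (use e in \<open>simp add: Y_def algebra_simps diff_divide_distrib\<close>)
    qed
    have "((\<lambda>t. \<tau> - q t) \<longlongrightarrow> \<tau> - q\<^sub>0) at_top" by (intro tendsto_intros q_lim)
    then have "\<forall>\<^sub>F t in at_top. (\<tau> - q\<^sub>0) / 2 < \<tau> - q t" using \<tau> by (intro order_tendstoD(1)) auto
    then show "\<forall>\<^sub>F t in at_top. (\<tau> - q\<^sub>0) / 2 \<le> \<tau> - q t" by eventually_elim simp
    have "((\<lambda>t. (\<tau> / \<gamma> * (q t - \<tau>)) *\<^sub>R m t) \<longlongrightarrow> (\<tau> / \<gamma> * (q\<^sub>0 - \<tau>)) *\<^sub>R 0) at_top"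
      by (intro tendsto_intros q_lim m)
    then show "((\<lambda>t. (\<tau> / \<gamma> * (q t - \<tau>)) *\<^sub>R m t) \<longlongrightarrow> 0) at_top" by simp
  qed
  then have "((\<lambda>t. Y t + (\<tau> / \<gamma>) *\<^sub>R m t) \<longlongrightarrow> 0 + (\<tau> / \<gamma>) *\<^sub>R 0) at_top"
    by (intro tendsto_intros m)
  moreover have "\<forall>\<^sub>F t in at_top. Y t + (\<tau> / \<gamma>) *\<^sub>R m t = (1 / (e t)\<^sup>2) *\<^sub>R A (h t)"
    using eventually_ge_at_top[of T]
  proof eventually_elim
    case (elim t)
    then show ?case using e_pos[OF elim] by (simp add: Y_def \<zeta>_def algebra_simps)
  qed
  ultimately have "((\<lambda>t. (1 / (e t)\<^sup>2) *\<^sub>R A (h t)) \<longlongrightarrow> 0 + (\<tau> / \<gamma>) *\<^sub>R 0) at_top"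
    by (rule Lim_transform_eventually)
  then show ?thesis by simp
qed

text \<open>Compactness: at a cluster point of the bounded function \<open>h\<close> both the gap
  and the constraint violation vanish, so adding \<open>xs\<close> gives a solution, and minimality
  of the norm of \<open>xs\<close> determines the sign.\<close>

lemma xs_h_lower:
  assumes \<eta>: "\<eta> > 0"
  shows "\<forall>\<^sub>F t in at_top. xs \<bullet> h t > - \<eta>"
proof (rule ccontr)
  assume neg: "\<not> ?thesis"
  obtain M where hM: "\<forall>\<^sub>F t in at_top. norm (h t) \<le> M"
    and GM: "\<forall>\<^sub>F t in at_top. G (x t) \<le> M * (e t)\<^sup>2" by (rule h_m_bounded)
  have "((\<lambda>t. M * (e t)\<^sup>2) \<longlongrightarrow> M * 0\<^sup>2) at_top" by (intro tendsto_intros e_lim)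
  then have "((\<lambda>t. M * (e t)\<^sup>2) \<longlongrightarrow> 0) at_top" by simp
  then have Gx: "((\<lambda>t. G (xs + h t)) \<longlongrightarrow> 0) at_top"
    by (rule Lim_null_comparison[rotated]) (use GM in eventually_elim, auto simp: G_nonneg h_def)
  \<comment> \<open>If the claim fails, the reverse inequality holds at arbitrarily late times, in
    particular at times where the eventual bound on \<open>h\<close> is in force.\<close>
  have "\<forall>n. \<exists>t. t \<ge> real n \<and> norm (h t) \<le> M \<and> xs \<bullet> h t \<le> - \<eta>"
  proof (rule allI, rule ccontr)
    fix n assume a: "\<nexists>t. t \<ge> real n \<and> norm (h t) \<le> M \<and> xs \<bullet> h t \<le> - \<eta>"
    have "\<forall>\<^sub>F t in at_top. xs \<bullet> h t > - \<eta>"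
      using hM eventually_ge_at_top[of "real n"] by eventually_elim (use a in force)
    then show False using neg by simp
  qed
  from choice[OF this] obtain s where s: "\<And>n. s n \<ge> real n" "\<And>n. norm (h (s n)) \<le> M" "\<And>n. xs \<bullet> h (s n) \<le> - \<eta>"
    by blast
  have "bounded (range (\<lambda>n. h (s n)))" using s(2) by (auto simp: bounded_iff)
  then obtain hl \<phi> where \<phi>: "strict_mono \<phi>" and lim: "((\<lambda>n. h (s n)) \<circ> \<phi>) \<longlonglongrightarrow> hl"
    using bounded_imp_convergent_subsequence by blast
  have "filterlim s at_top sequentially"
    by (rule filterlim_at_top_mono[OF filterlim_real_sequentially]) (use s(1) in auto)
  then have sl: "filterlim (\<lambda>n. s (\<phi> n)) at_top sequentially"
    using \<phi> by (rule filterlim_compose[OF _ filterlim_subseq])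
  have lim': "(\<lambda>n. h (s (\<phi> n))) \<longlonglongrightarrow> hl" using lim by (simp add: o_def)
  have "isCont G y" for y using G_deriv[of y] by (rule has_derivative_continuous)
  then have "(\<lambda>n. G (xs + h (s (\<phi> n)))) \<longlonglongrightarrow> G (xs + hl)"
    by (intro isCont_tendsto_compose[of _ G] tendsto_intros lim')
  then have "G (xs + hl) = 0"
    using filterlim_compose[OF Gx sl] by (rule LIMSEQ_unique)
  moreover have "bounded_linear A" using lin by (simp add: linear_conv_bounded_linear)
  then have "(\<lambda>n. A (h (s (\<phi> n)))) \<longlonglongrightarrow> A hl" using lim' by (rule bounded_linear.tendsto)
  then have "A hl = 0" using filterlim_compose[OF A_h_lim sl] by (rule LIMSEQ_unique)
  ultimately have "0 \<le> xs \<bullet> hl" using xs_min_norm[of "xs + hl"] by (simp add: linear_add[OF lin])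
  moreover have "(\<lambda>n. xs \<bullet> h (s (\<phi> n))) \<longlonglongrightarrow> xs \<bullet> hl" by (intro tendsto_intros lim')
  then have "xs \<bullet> hl \<le> - \<eta>" by (rule LIMSEQ_le_const2) (use s(3) in auto)
  ultimately show False using \<eta> by simp
qed

text \<open>The decay argument is repeated with the lower bound for \<open>xs \<bullet> h t\<close>
  in place of Young's inequality, so the equilibrium level of \<open>W\<close> becomes arbitrarily
  small.\<close>

lemma Q_lim: "(Q \<longlongrightarrow> 0) at_top"
proof (rule order_tendstoI)
  fix a :: real assume "a < 0"
  then show "\<forall>\<^sub>F t in at_top. a < Q t" by (intro always_eventually allI) (rule less_le_trans[OF _ Q_bounds(5)])
next
  fix b :: real assume b: "0 < b"
  obtain a c C k where kc: "a > 0" "c > 0" "C > 0"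
    and lo: "\<forall>\<^sub>F t in at_top. c * Q t + xs \<bullet> h t \<le> W k t"
    and up: "\<forall>\<^sub>F t in at_top. W k t \<le> C * Q t + xs \<bullet> h t"
    and est: "\<forall>\<eta>>0. \<forall>\<^sub>F t in at_top. DW k t \<le> - a * Q t - \<tau> * (xs \<bullet> h t) + \<eta>"
    by (rule energy_estimate)
  \<comment> \<open>By \<open>r \<le> a / C\<close> the dissipation pays for
    \<open>r * W k t\<close>; by \<open>r \<le> \<tau>\<close> the remaining linear term
    \<open>(\<tau> - r) * (- (xs \<bullet> h t))\<close> is at most
    \<open>\<tau> * \<eta>\<close>.\<close>
  define r where "r = min (a / C) \<tau>"
  have r: "r > 0" "r * C \<le> a" "r \<le> \<tau>" using kc \<tau>_pos by (auto simp: r_def min_def field_simps)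
  \<comment> \<open>The first entry turns \<open>W k t < c * b / 2\<close> and
    \<open>xs \<bullet> h t > - \<eta>\<close> into \<open>Q t < b\<close>. The second puts the
    equilibrium \<open>(1 + \<tau>) * \<eta> / r\<close> below \<open>c * b / 2\<close>, strictly
    because of the factor 2.\<close>
  define \<eta> where "\<eta> = min (c * b / 2) (r * (c * b / 2) / (2 * (1 + \<tau>)))"
  have \<eta>: "\<eta> > 0" using kc b r \<tau>_pos by (simp add: \<eta>_def)
  have "\<eta> \<le> r * (c * b / 2) / (2 * (1 + \<tau>))" by (simp add: \<eta>_def)
  moreover have "0 < 2 * (1 + \<tau>)" using \<tau>_pos by simp
  ultimately have "\<eta> * (2 * (1 + \<tau>)) \<le> r * (c * b / 2)" by (simp only: pos_le_divide_eq)
  moreover have "0 < (1 + \<tau>) * \<eta>" using \<eta> \<tau>_pos by simp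
  moreover have "\<eta> * (2 * (1 + \<tau>)) = 2 * ((1 + \<tau>) * \<eta>)" by (simp only: mult_ac)
  ultimately have \<eta>1: "(1 + \<tau>) * \<eta> < r * (c * b / 2)" by linarith
  have \<eta>2: "\<eta> \<le> c * b / 2" unfolding \<eta>_def by (rule min.cobounded1)
  have "\<forall>\<^sub>F t in at_top. W k t < c * b / 2"
  proof (rule eventually_less_if_linear_decay[OF r(1) \<eta>1 S_deriv S_lim])
    show "\<forall>\<^sub>F t in at_top. \<exists>d. (W k has_real_derivative d) (at t) \<and> d \<le> e t * ((1 + \<tau>) * \<eta> - r * W k t)"
      using up est[rule_format, OF \<eta>] eventually_ge_at_top[of T] xs_h_lower[OF \<eta>]
    proof eventually_elim
      case (elim t)
      have "r * W k t \<le> r * (C * Q t + xs \<bullet> h t)" using r elim by (intro mult_left_mono) auto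
      moreover have "r * C * Q t \<le> a * Q t" using r Q_bounds(5) by (intro mult_right_mono) auto
      moreover have "(\<tau> - r) * (- (xs \<bullet> h t)) \<le> (\<tau> - r) * \<eta>" using r elim by (intro mult_left_mono) auto
      moreover have "(\<tau> - r) * \<eta> \<le> \<tau> * \<eta>" using r \<eta> by (intro mult_right_mono) auto
      ultimately have "DW k t \<le> (1 + \<tau>) * \<eta> - r * W k t"
        using elim(2) by (simp add: algebra_simps)
      then show ?case
        using W_deriv[OF elim(3), of k] e_pos[OF elim(3)] by (meson mult_left_mono less_imp_le)
    qed
  qed
  then show "\<forall>\<^sub>F t in at_top. Q t < b"
    using lo xs_h_lower[OF \<eta>]
  proof eventually_elim
    case (elim t)
    then have "c * Q t < c * b" using \<eta>2 by simp
    then show ?case using kc by simp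
  qed
qed

theorem flow_limits:
  shows "(u \<longlongrightarrow> 0) at_top" "(h \<longlongrightarrow> 0) at_top" "(m \<longlongrightarrow> 0) at_top"
    "((\<lambda>t. G (x t) / (e t)\<^sup>2) \<longlongrightarrow> 0) at_top"
    "((\<lambda>t. (1 / (e t)\<^sup>2) *\<^sub>R A (h t)) \<longlongrightarrow> 0) at_top"
proof -
  have sq: "(f \<longlongrightarrow> 0) at_top" if "\<And>t. (norm (f t))\<^sup>2 \<le> Q t" for f :: "real \<Rightarrow> 'z::real_normed_vector"
  proof (rule Lim_null_comparison)
    show "\<forall>\<^sub>F t in at_top. norm (f t) \<le> sqrt (Q t)" using that by (intro always_eventually allI real_le_rsqrt)
    show "((\<lambda>t. sqrt (Q t)) \<longlongrightarrow> 0) at_top" using tendsto_real_sqrt[OF Q_lim] by simp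
  qed
  show "(u \<longlongrightarrow> 0) at_top" "(h \<longlongrightarrow> 0) at_top" and m: "(m \<longlongrightarrow> 0) at_top"
    by (rule sq, rule Q_bounds)+
  show "((\<lambda>t. G (x t) / (e t)\<^sup>2) \<longlongrightarrow> 0) at_top"
    by (rule Lim_null_comparison[OF _ Q_lim]) (intro always_eventually allI, simp only: real_norm_def abs_of_nonneg Q_bounds)
  show "((\<lambda>t. (1 / (e t)\<^sup>2) *\<^sub>R A (h t)) \<longlongrightarrow> 0) at_top" by (rule A_h_div_lim[OF m])
qed

end

section \<open>The primal-dual system with Tikhonov regularization\<close>

text \<open>Splits the solution set into an affine part and a sublevel set, whose closedness and
  convexity can be checked separately; the projection onto it depends on both.\<close>

lemma constrained_argmin_eq_sublevel:
  assumes "s \<in> constrained_argmin f A b"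
  shows "constrained_argmin f A b = {x. A *v x = b} \<inter> {x. f x \<le> f s}"
  using assms unfolding constrained_argmin_def is_arg_min_def by (auto simp: not_less)

lemma closed_convex_constrained_argmin:
  fixes f :: "real^'n \<Rightarrow> real"
  assumes cvx: "convex_on UNIV f" and cont: "continuous_on UNIV f"
  shows "closed (constrained_argmin f A b)" "convex (constrained_argmin f A b)"
proof -
  have "closed (constrained_argmin f A b) \<and> convex (constrained_argmin f A b)"
  proof (cases "constrained_argmin f A b = {}")
    case False
    then obtain s where s: "s \<in> constrained_argmin f A b" by blast
    have "closed {x. A *v x = b}"
      by (intro closed_Collect_eq continuous_intros linear_continuous_on) (simp add: linear_linear)
    moreover have "convex {x. A *v x = b}"
      by (auto simp: convex_def matrix_vector_right_distrib matrix_vector_mult_scaleR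
          simp flip: scaleR_add_left)
    moreover have "closed {x. f x \<le> f s}" by (intro closed_Collect_le cont continuous_intros)
    moreover have "convex {x. f x \<le> f s}"
      unfolding convex_def
    proof (intro ballI allI impI, unfold mem_Collect_eq)
      fix x y and u v :: real
      assume *: "f x \<le> f s" "f y \<le> f s" "0 \<le> u" "0 \<le> v" "u + v = 1"
      then have "f (u *\<^sub>R x + v *\<^sub>R y) \<le> u * f x + v * f y"
        using cvx by (simp add: convex_on_def)
      also have "\<dots> \<le> f s" using * by (intro convex_bound_le)
      finally show "f (u *\<^sub>R x + v *\<^sub>R y) \<le> f s" .
    qed
    ultimately show ?thesis
      unfolding constrained_argmin_eq_sublevel[OF s] by (auto intro: closed_Int convex_Int)
  qed simp
  then show "closed (constrained_argmin f A b)" "convex (constrained_argmin f A b)" by auto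
qed

lemma closest_point_in_constrained_argmin:
  fixes f :: "real^'n \<Rightarrow> real"
  assumes "convex_on UNIV f" and "\<And>x. GDERIV f x :> grad x" and "constrained_argmin f A b \<noteq> {}"
  shows "closest_point (constrained_argmin f A b) a \<in> constrained_argmin f A b"
    and "A *v closest_point (constrained_argmin f A b) a = b"
proof -
  have "continuous_on UNIV f"
    using assms(2) unfolding gderiv_def
    by (meson continuous_at_imp_continuous_on has_derivative_continuous)
  then show "closest_point (constrained_argmin f A b) a \<in> constrained_argmin f A b"
    by (intro closest_point_in_set closed_convex_constrained_argmin assms)
  then show "A *v closest_point (constrained_argmin f A b) a = b"
    by (simp add: constrained_argmin_def is_arg_min_def)
qed

section \<open>The gap of the augmented Lagrangian\<close>

definition aug_gap ::
  "(real^'n \<Rightarrow> real) \<Rightarrow> real^'n^'m \<Rightarrow> real^'m \<Rightarrow> real \<Rightarrow> real^'m \<Rightarrow> real^'n \<Rightarrow> real^'n \<Rightarrow> real"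
  where "aug_gap f A b \<rho> \<nu> xs y
    = lagrangian f A b y \<nu> - lagrangian f A b xs \<nu> + \<rho> / 2 * ((A *v y - b) \<bullet> (A *v y - b))"

text \<open>This is the force of objective and constraint with \<open>\<nu>\<close> in place of the
  current multiplier; what remains is \<open>transpose A *v (\<mu> t - \<nu>)\<close>, so the
  multiplier enters only through its error.\<close>

definition aug_grad ::
  "(real^'n \<Rightarrow> real^'n) \<Rightarrow> real^'n^'m \<Rightarrow> real^'m \<Rightarrow> real \<Rightarrow> real^'m \<Rightarrow> real^'n \<Rightarrow> real^'n"
  where "aug_grad grad A b \<rho> \<nu> y
    = grad y + transpose A *v \<nu> + \<rho> *\<^sub>R (transpose A *v (A *v y - b))"

lemma transpose_inner: "(transpose A *v w) \<bullet> v = w \<bullet> (A *v (v :: real^'n))"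
  using adjoint_works[of "(*v) A" v w] by (simp add: adjoint_matrix inner_commute)

text \<open>The penalty exceeds its linearization by exactly \<open>\<rho> / 2\<close> times the
  square of \<open>A *v (z - y)\<close>, so the inequality for \<open>f\<close> carries
  over.\<close>

lemma aug_gap_grad_ineq:
  assumes "f z \<ge> f y + grad y \<bullet> (z - y)" and "\<rho> \<ge> 0"
  shows "aug_gap f A b \<rho> \<nu> xs z \<ge> aug_gap f A b \<rho> \<nu> xs y + aug_grad grad A b \<rho> \<nu> y \<bullet> (z - y)"
proof -
  define d where "d = A *v (z - y)"
  define w where "w = A *v y - b"
  have z: "A *v z - b = w + d" by (simp add: w_def d_def matrix_vector_mult_diff_distrib)
  have "aug_gap f A b \<rho> \<nu> xs z - aug_gap f A b \<rho> \<nu> xs y - aug_grad grad A b \<rho> \<nu> y \<bullet> (z - y)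
    = (f z - f y - grad y \<bullet> (z - y)) + \<rho> / 2 * (d \<bullet> d)"
    unfolding aug_gap_def aug_grad_def lagrangian_def z w_def[symmetric]
      inner_add_left[of "grad y + _"] inner_add_left[of "grad y"] inner_scaleR_left transpose_inner d_def[symmetric]
    by (simp add: inner_add_left inner_add_right distrib_left inner_commute[of d w])
  moreover have "\<rho> / 2 * (d \<bullet> d) \<ge> 0" using assms(2) by simp
  ultimately show ?thesis using assms(1) by linarith
qed

lemma aug_gap_deriv:
  assumes "(f has_derivative (\<lambda>v. grad y \<bullet> v)) (at y)"
  shows "(aug_gap f A b \<rho> \<nu> xs has_derivative (\<lambda>v. aug_grad grad A b \<rho> \<nu> y \<bullet> v)) (at y)"
proof -
  have A: "((\<lambda>y. A *v y - b) has_derivative (\<lambda>v. A *v v)) (at y)"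
    using has_derivative_diff[OF bounded_linear.has_derivative[OF matrix_vector_mul_bounded_linear has_derivative_ident] has_derivative_const]
    by simp
  have "((\<lambda>y. (f y + \<nu> \<bullet> (A *v y - b)) - lagrangian f A b xs \<nu> + \<rho> / 2 * ((A *v y - b) \<bullet> (A *v y - b)))
     has_derivative (\<lambda>v. (grad y \<bullet> v + \<nu> \<bullet> (A *v v)) - 0
       + \<rho> / 2 * ((A *v y - b) \<bullet> (A *v v) + (A *v v) \<bullet> (A *v y - b)))) (at y)"
    by (intro has_derivative_add has_derivative_diff has_derivative_const assms
        bounded_linear.has_derivative[OF bounded_linear_inner_right]
        bounded_linear.has_derivative[OF bounded_linear_mult_right] has_derivative_inner A)
  then show ?thesis
    unfolding aug_gap_def lagrangian_def
    by (rule back_subst[where P = "\<lambda>D. (_ has_derivative D) (at y)"])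
      (unfold aug_grad_def inner_add_left inner_scaleR_left transpose_inner,
        simp add: fun_eq_iff inner_commute[of "A *v y - b"])
qed

lemma aug_grad_lipschitz:
  fixes A :: "real^'n^'m"
  assumes "L-lipschitz_on UNIV grad" "L > 0" "\<rho> > 0"
  obtains \<Lambda> where "\<Lambda> > 0"
    "\<And>y z. norm (aug_grad grad A b \<rho> \<nu> y - aug_grad grad A b \<rho> \<nu> z) \<le> \<Lambda> * norm (y - z)"
proof -
  have "linear (\<lambda>v. transpose A *v (A *v v))"
    by (intro linearI) (simp_all add: matrix_vector_right_distrib matrix_vector_mult_scaleR)
  then obtain K where K: "K > 0" "\<And>v. norm (transpose A *v (A *v v)) \<le> K * norm v"
    using linear_bounded_pos by blast
  show ?thesis
  proof (rule that)
    show "L + \<rho> * K > 0" using assms K by (simp add: add_pos_pos)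
    fix y z
    have "aug_grad grad A b \<rho> \<nu> y - aug_grad grad A b \<rho> \<nu> z
        = (grad y - grad z) + \<rho> *\<^sub>R (transpose A *v (A *v (y - z)))"
      by (simp add: aug_grad_def algebra_simps matrix_vector_mult_diff_distrib)
    also have "norm \<dots> \<le> L * norm (y - z) + \<rho> * (K * norm (y - z))"
    proof (rule order_trans[OF norm_triangle_ineq add_mono])
      show "norm (grad y - grad z) \<le> L * norm (y - z)"
        using lipschitz_onD[OF assms(1), of y z] by (simp add: dist_norm)
      show "norm (\<rho> *\<^sub>R (transpose A *v (A *v (y - z)))) \<le> \<rho> * (K * norm (y - z))"
        using K(2)[of "y - z"] assms(3) by (simp add: mult_left_mono)
    qed
    finally show "norm (aug_grad grad A b \<rho> \<nu> y - aug_grad grad A b \<rho> \<nu> z) \<le> (L + \<rho> * K) * norm (y - z)"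
      by (simp add: algebra_simps)
  qed
qed

text \<open>Orthogonality to the range of \<open>A\<close> is a conservation law of the multiplier equation.\<close>

lemma multiplier_in_range:
  fixes A :: "real^'n^'m"
  assumes deriv: "\<And>t. t \<ge> t0 \<Longrightarrow> (\<mu> has_vector_derivative \<mu>' t) (at t within {t0..})"
    and \<mu>': "\<And>t. t \<ge> t0 \<Longrightarrow> \<mu>' t \<in> range ((*v) A)"
    and init: "\<mu> t0 - \<nu> \<in> range ((*v) A)" and t: "t \<ge> t0"
  shows "\<mu> t - \<nu> \<in> range ((*v) A)"
proof -
  have sub: "subspace (range ((*v) A))" by (intro linear_subspace_image) auto
  \<comment> \<open>\<open>z\<close> is the part of the error at the fixed time \<open>t\<close>
    orthogonal to the range. Its product with \<open>\<mu> s - \<nu>\<close> is constant in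
    \<open>s\<close> and vanishes at \<open>t0\<close>, which forces \<open>z = 0\<close>.\<close>
  obtain y z where yz: "y \<in> span (range ((*v) A))" "\<And>w. w \<in> span (range ((*v) A)) \<Longrightarrow> orthogonal z w"
    "\<mu> t - \<nu> = y + z"
    using orthogonal_subspace_decomp_exists[of "range ((*v) A)" "\<mu> t - \<nu>"] by blast
  have orth: "z \<bullet> w = 0" if "w \<in> range ((*v) A)" for w
    using yz(2) that by (auto simp: orthogonal_def intro: span_base)
  have d: "((\<lambda>s. z \<bullet> (\<mu> s - \<nu>)) has_vector_derivative 0) (at s within {t0..})" if "s \<in> {t0..}" for s
  proof -
    have "((\<lambda>s. z \<bullet> (\<mu> s - \<nu>)) has_vector_derivative z \<bullet> (\<mu>' s - 0)) (at s within {t0..})"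
      by (intro bounded_linear.has_vector_derivative[OF bounded_linear_inner_right]
          has_vector_derivative_diff deriv has_vector_derivative_const) (use that in auto)
    then show ?thesis using orth[OF \<mu>'[of s]] that by simp
  qed
  obtain k where "\<And>s. s \<in> {t0..} \<Longrightarrow> z \<bullet> (\<mu> s - \<nu>) = k"
    using has_vector_derivative_zero_constant[OF convex_real_interval(1) d] by blast
  then have "z \<bullet> (\<mu> t - \<nu>) = z \<bullet> (\<mu> t0 - \<nu>)" using t by simp
  also have "\<dots> = 0" using init by (rule orth)
  finally have "z \<bullet> z = 0" using yz(2)[OF yz(1)] unfolding yz(3) by (simp add: inner_add_right orthogonal_def)
  then show ?thesis using yz sub by (simp add: span_eq_iff[THEN iffD2])
qed

text \<open>A vector \<open>A *v v\<close> in the kernel of the transpose is orthogonal to itself,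
  so the transpose is injective on the range; in finite dimension this gives a lower bound.\<close>

lemma transpose_coercive_on_range:
  fixes A :: "real^'n^'m"
  obtains \<kappa> where "\<kappa> > 0" "\<And>w. w \<in> range ((*v) A) \<Longrightarrow> \<kappa> * norm w \<le> norm (transpose A *v w)"
proof -
  have sub: "subspace (range ((*v) A))" by (intro linear_subspace_image) auto
  have "\<forall>w\<in>range ((*v) A). transpose A *v w = 0 \<longrightarrow> w = 0"
  proof (intro ballI impI)
    fix w assume w: "w \<in> range ((*v) A)" "transpose A *v w = 0"
    then obtain v where "w = A *v v" by blast
    then have "w \<bullet> w = (transpose A *v w) \<bullet> v" unfolding transpose_inner by simp
    then show "w = 0" using w(2) by simp
  qed
  then have "\<exists>e>0. \<forall>w\<in>range ((*v) A). e * norm w \<le> norm (transpose A *v w)"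
    by (intro injective_imp_isometric closed_subspace sub matrix_vector_mul_bounded_linear)
  then show ?thesis using that by blast
qed

text \<open>The new time \<open>S\<close> is an antiderivative of \<open>e\<close>; it diverges
  because \<open>r \<le> 2\<close>, logarithmically in the critical case. There \<open>q\<close> is
  constant, otherwise it tends to 0.\<close>

lemma tikhonov_rescaling:
  fixes c r :: real
  assumes c: "c > 0" and r: "0 < r" "r \<le> 2"
    and e_def: "e = (\<lambda>t. sqrt c * t powr (- (r / 2)))"
    and q_def: "q = (\<lambda>t. r / sqrt c * t powr (r / 2 - 1))"
    and S_def: "S = (\<lambda>t. if r = 2 then sqrt c * ln t else sqrt c * t powr (1 - r / 2) / (1 - r / 2))"
    and q\<^sub>0_def: "q\<^sub>0 = (if r = 2 then 2 / sqrt c else 0)"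
  shows "\<And>t. t > 0 \<Longrightarrow> e t > 0" "\<And>t. t > 0 \<Longrightarrow> sqrt (tikhonov c r t) = e t"
    "\<And>t. t > 0 \<Longrightarrow> tikhonov c r t = (e t)\<^sup>2" "\<And>t. t > 0 \<Longrightarrow> t powr (- r) = (e t)\<^sup>2 / c"
    "\<And>t. t > 0 \<Longrightarrow> (e has_real_derivative - (q t / 2) * (e t)\<^sup>2) (at t)"
    "(e \<longlongrightarrow> 0) at_top"
    "(q \<longlongrightarrow> q\<^sub>0) at_top"
    "\<And>t. t > 0 \<Longrightarrow> (S has_real_derivative e t) (at t)" "filterlim S at_top at_top"
proof -
  show e_pos: "e t > 0" if "t > 0" for t using that c by (simp add: e_def)
  have e_sq: "(e t)\<^sup>2 = c * t powr (- r)" if "t > 0" for t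
    using that c by (simp add: e_def power_mult_distrib powr_power)
  show tik: "tikhonov c r t = (e t)\<^sup>2" if "t > 0" for t
    using e_sq[OF that] that by (simp add: tikhonov_def powr_minus field_simps)
  show "t powr (- r) = (e t)\<^sup>2 / c" if "t > 0" for t using e_sq[OF that] c by simp
  show "sqrt (tikhonov c r t) = e t" if "t > 0" for t using tik[OF that] e_pos[OF that] by simp
  show "(e has_real_derivative - (q t / 2) * (e t)\<^sup>2) (at t)" if t: "t > 0" for t
  proof -
    have "(e has_real_derivative sqrt c * (- (r / 2) * t powr (- (r / 2) - 1))) (at t)"
      unfolding e_def by (intro DERIV_cmult has_real_derivative_powr t)
    moreover have "t powr (- (r / 2) - 1) = t powr (r / 2 - 1) * t powr (- r)"
      by (simp flip: powr_add)
    moreover have "sqrt c * (- (r / 2) * (t powr (r / 2 - 1) * t powr (- r)))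
        = - (q t / 2) * (c * t powr (- r))"
      using c by (simp add: q_def field_simps)
    ultimately show ?thesis unfolding e_sq[OF t] by metis
  qed
  have "((\<lambda>t. t powr (- (r / 2))) \<longlongrightarrow> 0) at_top"
    using r by (intro tendsto_neg_powr filterlim_ident) auto
  then show "(e \<longlongrightarrow> 0) at_top" unfolding e_def by (rule tendsto_mult_right_zero)
  show "(q \<longlongrightarrow> q\<^sub>0) at_top"
  proof (cases "r = 2")
    case True
    have "\<forall>\<^sub>F t in at_top. 2 / sqrt c = q t"
      using eventually_gt_at_top[of 0] by eventually_elim (simp add: q_def True)
    then show ?thesis using True by (simp add: q\<^sub>0_def tendsto_cong[symmetric])
  next
    case False
    then have "((\<lambda>t. t powr (r / 2 - 1)) \<longlongrightarrow> 0) at_top"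
      using r by (intro tendsto_neg_powr filterlim_ident) auto
    then show ?thesis using tendsto_mult_right_zero[of _ _ "r / sqrt c"] False unfolding q_def q\<^sub>0_def by simp
  qed
  show "(S has_real_derivative e t) (at t)" if t: "t > 0" for t
  proof (cases "r = 2")
    case True
    have "((\<lambda>t. sqrt c * ln t) has_real_derivative sqrt c * inverse t) (at t)"
      by (intro DERIV_cmult DERIV_ln t)
    then show ?thesis using t by (simp add: S_def e_def True powr_minus)
  next
    case False
    have "((\<lambda>t. sqrt c * t powr (1 - r / 2) / (1 - r / 2)) has_real_derivative
        sqrt c * ((1 - r / 2) * t powr (1 - r / 2 - 1)) / (1 - r / 2)) (at t)"
      by (intro DERIV_cdivide DERIV_cmult has_real_derivative_powr t)
    then show ?thesis using False by (simp add: S_def e_def)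
  qed
  show "filterlim S at_top at_top"
  proof (cases "r = 2")
    case True
    then show ?thesis unfolding S_def
      using filterlim_tendsto_pos_mult_at_top[OF tendsto_const _ ln_at_top, of "sqrt c"] c by simp
  next
    case False
    then have "filterlim (\<lambda>t::real. t powr (1 - r / 2)) at_top at_top"
      using r by (intro real_powr_at_top) auto
    then have "filterlim (\<lambda>t. sqrt c / (1 - r / 2) * t powr (1 - r / 2)) at_top at_top"
      using False r c by (intro filterlim_tendsto_pos_mult_at_top[OF tendsto_const]) auto
    then show ?thesis using False by (simp add: S_def)
  qed
qed

text \<open>Translates a solution with \<open>\<sigma> = \<tau> * \<gamma>\<close> into the rescaled
  flow. The flow starts at \<open>t0 + 1\<close>, because derivatives at \<open>t0\<close> are
  one-sided.\<close>

lemma flow_of_solution: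
  fixes f :: "real^'n \<Rightarrow> real" and A :: "real^'n^'m" and r c :: real
  assumes e_def: "e = (\<lambda>t. sqrt c * t powr (- (r / 2)))"
    and q_def: "q = (\<lambda>t. r / sqrt c * t powr (r / 2 - 1))"
    and S_def: "S = (\<lambda>t. if r = 2 then sqrt c * ln t else sqrt c * t powr (1 - r / 2) / (1 - r / 2))"
    and q\<^sub>0_def: "q\<^sub>0 = (if r = 2 then 2 / sqrt c else 0)"
    and cvx: "convex_on UNIV f" and grad: "\<And>x. GDERIV f x :> grad x"
    and L: "L > 0" "L-lipschitz_on UNIV grad"
    and ne: "constrained_argmin f A b \<noteq> {}"
    and xs: "xs = closest_point (constrained_argmin f A b) 0"
    and pos: "t0 > 0" "\<rho> > 0" "\<gamma> > 0" "c > 0" "0 < r" "r \<le> 2"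
    and \<beta>: "\<And>t. t \<ge> t0 \<Longrightarrow> \<beta> t \<ge> 0" "bounded (\<beta> ` {t0..})"
    and \<tau>: "\<tau> > q\<^sub>0" and \<delta>: "\<delta> > \<tau> + q\<^sub>0 / 2"
    and sol: "primal_dual_solution grad A b \<delta> \<rho> \<gamma> (\<tau> * \<gamma>) \<beta> (tikhonov c r) t0 x x' \<mu>"
    and \<nu>: "grad xs + transpose A *v \<nu> = 0" and init: "\<mu> t0 - \<nu> \<in> range ((*v) A)"
  obtains \<Lambda> B \<kappa> where
    "rescaled_flow x (\<lambda>t. (1 / e t) *\<^sub>R x' t) (\<lambda>t. \<mu> t - \<nu>) ((*v) A)
      (aug_gap f A b \<rho> \<nu> xs) (aug_grad grad A b \<rho> \<nu>) xs e q \<beta> S \<delta> \<gamma> \<tau> \<Lambda> B q\<^sub>0 \<kappa> (t0 + 1)"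
proof -
  note tik = tikhonov_rescaling[OF pos(4-6) e_def q_def S_def q\<^sub>0_def]
  have fd: "(f has_derivative (\<lambda>v. grad y \<bullet> v)) (at y)" for y
    using grad[of y] by (simp add: gderiv_def inner_commute)
  have f_ineq: "f z \<ge> f y + grad y \<bullet> (z - y)" for y z by (rule convex_on_gradient_ineq[OF cvx fd])
  have cont: "continuous_on UNIV f"
    using fd by (meson continuous_at_imp_continuous_on has_derivative_continuous)
  note argmin = closed_convex_constrained_argmin[OF cvx cont, of A b]
  have xs_in: "xs \<in> constrained_argmin f A b"
    unfolding xs by (rule closest_point_in_constrained_argmin[OF cvx grad ne])
  have Axs: "A *v xs = b" unfolding xs by (rule closest_point_in_constrained_argmin[OF cvx grad ne])
  note fxs = constrained_argmin_eq_sublevel[OF xs_in]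
  have G_grad: "aug_gap f A b \<rho> \<nu> xs z \<ge> aug_gap f A b \<rho> \<nu> xs y + aug_grad grad A b \<rho> \<nu> y \<bullet> (z - y)" for y z
    by (rule aug_gap_grad_ineq[OF f_ineq]) (use pos in simp)
  have G_xs: "aug_gap f A b \<rho> \<nu> xs xs = 0" by (simp add: aug_gap_def Axs)
  \<comment> \<open>The optimality condition makes \<open>xs\<close> a critical point of the convex
    gap, hence a minimizer with value 0.\<close>
  have dG_xs: "aug_grad grad A b \<rho> \<nu> xs = 0" by (simp only: aug_grad_def Axs \<nu>) simp
  have G_nonneg: "aug_gap f A b \<rho> \<nu> xs y \<ge> 0" for y
    using G_grad[of xs y] by (simp add: G_xs dG_xs)
  have min_norm: "0 \<le> xs \<bullet> (y - xs)" if "aug_gap f A b \<rho> \<nu> xs y = 0" "A *v y = A *v xs" for y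
  proof -
    \<comment> \<open>Zero gap at a feasible point means \<open>f y = f xs\<close>; the obtuse-angle
      property of the projection of 0 then applies to \<open>y\<close>.\<close>
    have "y \<in> constrained_argmin f A b"
      using that unfolding fxs by (simp add: aug_gap_def lagrangian_def Axs)
    from closest_point_dot[OF argmin(2,1) this, of 0] show ?thesis by (simp add: xs[symmetric])
  qed
  obtain B where B: "\<And>t. t \<ge> t0 \<Longrightarrow> \<beta> t \<le> B"
  proof -
    obtain B where "\<forall>s\<in>\<beta> ` {t0..}. norm s \<le> B" using \<beta>(2) unfolding bounded_iff by blast
    then have "\<bar>\<beta> t\<bar> \<le> B" if "t \<ge> t0" for t using that by auto
    then have "\<beta> t \<le> B" if "t \<ge> t0" for t using that abs_le_D1 by blast
    then show ?thesis using that by blast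
  qed
  obtain \<Lambda> where \<Lambda>: "\<Lambda> > 0"
    "\<And>y z. norm (aug_grad grad A b \<rho> \<nu> y - aug_grad grad A b \<rho> \<nu> z) \<le> \<Lambda> * norm (y - z)"
    using aug_grad_lipschitz[OF L(2,1) pos(2)] by blast
  obtain \<kappa> where \<kappa>: "\<kappa> > 0" "\<And>w. w \<in> range ((*v) A) \<Longrightarrow> \<kappa> * norm w \<le> norm (transpose A *v w)"
    using transpose_coercive_on_range[of A] by blast
  obtain x'' \<mu>' where
      dx: "\<And>t. t \<ge> t0 \<Longrightarrow> (x has_vector_derivative x' t) (at t within {t0..})"
    and dx': "\<And>t. t \<ge> t0 \<Longrightarrow> (x' has_vector_derivative x'' t) (at t within {t0..})"
    and d\<mu>: "\<And>t. t \<ge> t0 \<Longrightarrow> (\<mu> has_vector_derivative \<mu>' t) (at t within {t0..})"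
    and eq_x: "\<And>t. t \<ge> t0 \<Longrightarrow> x'' t + (\<delta> * sqrt (tikhonov c r t)) *\<^sub>R x' t + grad (x t + \<beta> t *\<^sub>R x' t)
            + transpose A *v \<mu> t
            + \<rho> *\<^sub>R (transpose A *v (A *v (x t + \<beta> t *\<^sub>R x' t) - b))
            + tikhonov c r t *\<^sub>R x t = 0"
    and eq_\<mu>: "\<And>t. t \<ge> t0 \<Longrightarrow> \<mu>' t = (\<gamma> / sqrt (tikhonov c r t)) *\<^sub>R
            (A *v (x t + (\<gamma> / (\<tau> * \<gamma> * sqrt (tikhonov c r t))) *\<^sub>R x' t) - b)"
    using sol unfolding primal_dual_solution_def by blast
  have at: "at t within {t0..} = at t" if "t \<ge> t0 + 1" for t
    using that by (intro at_within_interior) auto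
  have q0: "q\<^sub>0 \<ge> 0" using pos by (simp add: q\<^sub>0_def)
  then have \<tau>0: "\<tau> > 0" using \<tau> by simp
  \<comment> \<open>Writing \<open>b\<close> as \<open>A *v xs\<close> puts the residual, and with
    it the multiplier velocity, into the range of \<open>A\<close>.\<close>
  have \<mu>'_range: "\<mu>' t \<in> range ((*v) A)" if "t \<ge> t0" for t
  proof -
    have "\<mu>' t = A *v ((\<gamma> / sqrt (tikhonov c r t)) *\<^sub>R
            (x t + (\<gamma> / (\<tau> * \<gamma> * sqrt (tikhonov c r t))) *\<^sub>R x' t - xs))"
      unfolding eq_\<mu>[OF that] by (simp only: matrix_vector_mult_scaleR matrix_vector_mult_diff_distrib Axs)
    then show ?thesis by simp
  qed
  have "rescaled_flow x (\<lambda>t. (1 / e t) *\<^sub>R x' t) (\<lambda>t. \<mu> t - \<nu>) ((*v) A)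
      (aug_gap f A b \<rho> \<nu> xs) (aug_grad grad A b \<rho> \<nu>) xs e q \<beta> S \<delta> \<gamma> \<tau> \<Lambda> B q\<^sub>0 \<kappa> (t0 + 1)"
  proof (rule rescaled_flow.intro)
    show "linear ((*v) A)" by simp
    show "(aug_gap f A b \<rho> \<nu> xs has_derivative (\<lambda>v. aug_grad grad A b \<rho> \<nu> y \<bullet> v)) (at y)" for y
      by (rule aug_gap_deriv[OF fd])
    show "e t > 0" "(e has_real_derivative - (q t / 2) * (e t)\<^sup>2) (at t)"
      "(S has_real_derivative e t) (at t)" "0 \<le> \<beta> t" "\<beta> t \<le> B" if "t0 + 1 \<le> t" for t
      using tik(1,5,8)[of t] \<beta>(1)[of t] B[of t] that pos by auto
    show "\<kappa> * norm (\<mu> t - \<nu>) \<le> norm (adjoint ((*v) A) (\<mu> t - \<nu>))" if "t0 + 1 \<le> t" for t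
    proof -
      have "\<mu> t - \<nu> \<in> range ((*v) A)"
        by (rule multiplier_in_range[OF d\<mu> \<mu>'_range init]) (use that in auto)
      then show ?thesis unfolding adjoint_matrix by (rule \<kappa>(2))
    qed
    fix t assume t1: "t0 + 1 \<le> t"
    then have t: "t \<ge> t0" and tpos: "t > 0" using pos by auto
    have e: "e t > 0" by (rule tik(1)[OF tpos])
    define u where "u = (\<lambda>t. (1 / e t) *\<^sub>R x' t)"
    have x'u: "x' t = e t *\<^sub>R u t" using e by (simp add: u_def)
    show "(x has_vector_derivative e t *\<^sub>R (1 / e t) *\<^sub>R x' t) (at t)"
      using dx[OF t] e unfolding at[OF t1] by simp
    have de: "((\<lambda>t. 1 / e t) has_real_derivative q t / 2) (at t)"
      using e by (auto intro!: derivative_eq_intros tik(5) tpos simp: power2_eq_square)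
    \<comment> \<open>With \<open>\<sigma> = \<tau> * \<gamma>\<close> the extrapolation weight is
      \<open>1 / (\<tau> * e t)\<close>, so the extrapolated point minus \<open>xs\<close> is the
      variable \<open>V\<close> of the energy divided by \<open>\<tau>\<close>.\<close>
    have m_eq: "\<mu>' t = e t *\<^sub>R ((\<gamma> / (\<tau> * (e t)\<^sup>2)) *\<^sub>R (A *v (u t + \<tau> *\<^sub>R (x t - xs))))"
    proof -
      have "\<mu>' t = (\<gamma> / e t) *\<^sub>R (A *v (x t + (\<gamma> / (\<tau> * \<gamma> * e t)) *\<^sub>R x' t - xs))"
        unfolding eq_\<mu>[OF t] tik(2)[OF tpos] by (simp add: matrix_vector_mult_diff_distrib Axs)
      also have "x t + (\<gamma> / (\<tau> * \<gamma> * e t)) *\<^sub>R x' t - xs = (1 / \<tau>) *\<^sub>R (u t + \<tau> *\<^sub>R (x t - xs))"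
        using e \<tau>0 pos by (simp add: u_def scaleR_add_right)
      also have "(\<gamma> / e t) *\<^sub>R (A *v ((1 / \<tau>) *\<^sub>R (u t + \<tau> *\<^sub>R (x t - xs))))
          = (\<gamma> / e t * (1 / \<tau>)) *\<^sub>R (A *v (u t + \<tau> *\<^sub>R (x t - xs)))"
        by (simp only: matrix_vector_mult_scaleR scaleR_scaleR)
      also have "\<gamma> / e t * (1 / \<tau>) = e t * (\<gamma> / (\<tau> * (e t)\<^sup>2))"
        using e \<tau>0 by (simp add: power2_eq_square)
      finally show ?thesis by (simp only: scaleR_scaleR)
    qed
    have "((\<lambda>t. \<mu> t - \<nu>) has_vector_derivative \<mu>' t - 0) (at t)"
      using d\<mu>[OF t] unfolding at[OF t1] by (intro has_vector_derivative_diff has_vector_derivative_const)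
    then show "((\<lambda>t. \<mu> t - \<nu>) has_vector_derivative e t *\<^sub>R ((\<gamma> / (\<tau> * (e t)\<^sup>2)) *\<^sub>R
        (A *v ((1 / e t) *\<^sub>R x' t + \<tau> *\<^sub>R (x t - xs))))) (at t)"
      unfolding m_eq by (simp only: u_def diff_zero)
    define P where "P = aug_grad grad A b \<rho> \<nu> (x t + (\<beta> t * e t) *\<^sub>R u t) + transpose A *v (\<mu> t - \<nu>)"
    have x''_eq: "x'' t = - (\<delta> * (e t)\<^sup>2) *\<^sub>R u t - (e t)\<^sup>2 *\<^sub>R x t - P"
    proof -
      have y: "x t + \<beta> t *\<^sub>R x' t = x t + (\<beta> t * e t) *\<^sub>R u t" by (simp add: x'u)
      have P: "P = grad (x t + (\<beta> t * e t) *\<^sub>R u t) + transpose A *v \<mu> t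
          + \<rho> *\<^sub>R (transpose A *v (A *v (x t + (\<beta> t * e t) *\<^sub>R u t) - b))"
        unfolding P_def aug_grad_def matrix_vector_mult_diff_distrib[of "transpose A" "\<mu> t"] by simp
      have "x'' t + (\<delta> * e t) *\<^sub>R x' t + P + (e t)\<^sup>2 *\<^sub>R x t = 0"
        using eq_x[OF t] unfolding P tik(2)[OF tpos] unfolding tik(3)[OF tpos] y by (simp only: add.assoc)
      then have "x'' t = - ((\<delta> * e t) *\<^sub>R x' t + P + (e t)\<^sup>2 *\<^sub>R x t)"
        by (simp only: eq_neg_iff_add_eq_0 add.assoc)
      then show ?thesis by (simp add: x'u power2_eq_square mult.assoc)
    qed
    have "(u has_vector_derivative (1 / e t) *\<^sub>R x'' t + (q t / 2) *\<^sub>R x' t) (at t)"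
      using has_vector_derivative_scaleR[OF de dx'[OF t, unfolded at[OF t1]]] unfolding u_def .
    moreover have "(1 / e t) *\<^sub>R x'' t + (q t / 2) *\<^sub>R x' t
      = e t *\<^sub>R (- ((\<delta> - q t / 2) *\<^sub>R u t) - x t - (1 / (e t)\<^sup>2) *\<^sub>R P)"
      using e unfolding x''_eq x'u by (simp add: power2_eq_square algebra_simps)
    ultimately show "((\<lambda>t. (1 / e t) *\<^sub>R x' t) has_vector_derivative
        e t *\<^sub>R (- ((\<delta> - q t / 2) *\<^sub>R (1 / e t) *\<^sub>R x' t) - x t
          - (1 / (e t)\<^sup>2) *\<^sub>R (aug_grad grad A b \<rho> \<nu> (x t + (\<beta> t * e t) *\<^sub>R (1 / e t) *\<^sub>R x' t)
            + adjoint ((*v) A) (\<mu> t - \<nu>)))) (at t)"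
      unfolding P_def u_def adjoint_matrix by simp
  qed (fact G_grad G_nonneg G_xs \<Lambda> min_norm tik(6) tik(7) tik(9) pos(3) q0 \<tau> \<delta> \<kappa>(1))+
  then show ?thesis by (rule that)
qed

section \<open>Choice of the parameter and transfer of the limits\<close>

theorem corollary5p1:
  fixes f :: "real^'n \<Rightarrow> real" and grad :: "real^'n \<Rightarrow> real^'n"
    and A :: "real^'n^'m" and b :: "real^'m" and xs :: "real^'n"
    and \<beta> :: "real \<Rightarrow> real" and L t0 \<delta> \<rho> \<gamma> c r :: real
  assumes "convex_on UNIV f"
    and "\<And>x. GDERIV f x :> grad x"
    and "L > 0" and "L-lipschitz_on UNIV grad"
    and "constrained_argmin f A b \<noteq> {}"
    and "xs = closest_point (constrained_argmin f A b) 0"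
    and "t0 > 0" and "\<delta> > 0" and "\<rho> > 0" and "\<gamma> > 0"
    and "\<And>t. t \<ge> t0 \<Longrightarrow> \<beta> t \<ge> 0"
    and "continuous_on {t0..} \<beta>" and "bounded (\<beta> ` {t0..})"
    and "c > 0" and "0 < r" and "r \<le> 2"
    and "r < 2 \<or>
      (r = 2 \<and> ereal (\<delta> * sqrt c) > 3 + ereal L * Limsup at_top (\<lambda>t. ereal ((\<beta> t)\<^sup>2)))"
  shows "\<exists>\<sigma>>0. \<forall>x x' \<mu> \<mu>d.
    primal_dual_solution grad A b \<delta> \<rho> \<gamma> \<sigma> \<beta> (tikhonov c r) t0 x x' \<mu> \<longrightarrow>
    grad xs + transpose A *v \<mu>d = 0 \<longrightarrow>
    \<mu> t0 - \<mu>d \<in> range (\<lambda>z. A *v z) \<longrightarrow>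
      (x \<longlongrightarrow> xs) at_top \<and>
      (\<mu> \<longlongrightarrow> \<mu>d) at_top \<and>
      (\<lambda>t. lagrangian f A b (x t) \<mu>d - lagrangian f A b xs \<mu>d) \<in> o[at_top](\<lambda>t. t powr (- r)) \<and>
      (\<lambda>t. norm (A *v x t - b)) \<in> o[at_top](\<lambda>t. t powr (- r)) \<and>
      (\<lambda>t. \<bar>f (x t) - f xs\<bar>) \<in> o[at_top](\<lambda>t. t powr (- r)) \<and>
      (\<lambda>t. norm (x' t)) \<in> o[at_top](\<lambda>t. t powr (- (r / 2)))"
proof -
  define e where "e = (\<lambda>t. sqrt c * t powr (- (r / 2)))"
  define q where "q = (\<lambda>t. r / sqrt c * t powr (r / 2 - 1))"
  define S where "S = (\<lambda>t. if r = 2 then sqrt c * ln t else sqrt c * t powr (1 - r / 2) / (1 - r / 2))"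
  define q\<^sub>0 where "q\<^sub>0 = (if r = 2 then 2 / sqrt c else 0)"
  \<comment> \<open>In the critical case the assumption yields \<open>3 < \<delta> * sqrt c\<close>,
    as \<open>L\<close> times the limit superior is nonnegative; otherwise the claim is
    \<open>\<delta> > 0\<close>.\<close>
  have q0: "q\<^sub>0 * 3 / 2 < \<delta>"
  proof (cases "r = 2")
    case True
    then have "3 + ereal L * Limsup at_top (\<lambda>t. ereal ((\<beta> t)\<^sup>2)) < ereal (\<delta> * sqrt c)"
      using assms(17) by auto
    moreover have "0 \<le> Limsup at_top (\<lambda>t. ereal ((\<beta> t)\<^sup>2))"
      by (rule le_Limsup) auto
    then have "3 + 0 \<le> 3 + ereal L * Limsup at_top (\<lambda>t. ereal ((\<beta> t)\<^sup>2))"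
      using \<open>L > 0\<close> by (intro add_left_mono) (simp add: ereal_0_le_mult)
    ultimately have "3 + 0 < ereal (\<delta> * sqrt c)" by (rule le_less_trans[rotated])
    then have "3 < \<delta> * sqrt c" by simp
    then show ?thesis using True \<open>c > 0\<close> by (simp add: q\<^sub>0_def divide_simps)
  qed (use \<open>\<delta> > 0\<close> in \<open>simp add: q\<^sub>0_def\<close>)
  \<comment> \<open>The midpoint of the interval from \<open>q\<^sub>0\<close> to
    \<open>\<delta> - q\<^sub>0 / 2\<close>, nonempty by the previous inequality.\<close>
  define \<tau> where "\<tau> = \<delta> / 2 + q\<^sub>0 / 4"
  have \<tau>: "\<tau> > q\<^sub>0" "\<delta> > \<tau> + q\<^sub>0 / 2" using q0 by (auto simp: \<tau>_def)
  have "\<tau> > 0" using \<tau>(1) \<open>c > 0\<close> by (auto simp: q\<^sub>0_def split: if_splits intro: less_trans[rotated])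
  show ?thesis
  proof (intro exI[of _ "\<tau> * \<gamma>"] conjI allI impI)
    show "0 < \<tau> * \<gamma>" using \<open>\<tau> > 0\<close> \<open>\<gamma> > 0\<close> by simp
    fix x x' \<mu> \<mu>d
    assume sol: "primal_dual_solution grad A b \<delta> \<rho> \<gamma> (\<tau> * \<gamma>) \<beta> (tikhonov c r) t0 x x' \<mu>"
      and \<mu>d: "grad xs + transpose A *v \<mu>d = 0" and init: "\<mu> t0 - \<mu>d \<in> range (\<lambda>z. A *v z)"
    define z where "z = (\<lambda>t. A *v x t - b)"
    obtain \<Lambda> B \<kappa> where flow: "rescaled_flow x (\<lambda>t. (1 / e t) *\<^sub>R x' t) (\<lambda>t. \<mu> t - \<mu>d) ((*v) A)
        (aug_gap f A b \<rho> \<mu>d xs) (aug_grad grad A b \<rho> \<mu>d) xs e q \<beta> S \<delta> \<gamma> \<tau> \<Lambda> B q\<^sub>0 \<kappa> (t0 + 1)"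
      using flow_of_solution[OF e_def q_def S_def q\<^sub>0_def assms(1,2,3,4,5,6,7,9,10,14,15,16,11,13) \<tau> sol \<mu>d init]
      by blast
    note lims = rescaled_flow.flow_limits[OF flow]
    have h: "rescaled_flow.h x xs = (\<lambda>t. x t - xs)"
      by (rule ext) (rule rescaled_flow.h_def[OF flow])
    show x_lim: "(x \<longlongrightarrow> xs) at_top" using lims(2) unfolding h by (simp add: LIM_zero_iff)
    show "(\<mu> \<longlongrightarrow> \<mu>d) at_top" using lims(3) by (simp add: LIM_zero_iff)
    have Axs: "A *v xs = b"
      unfolding assms(6) by (rule closest_point_in_constrained_argmin[OF assms(1,2,5)])
    have Ah: "A *v (x t - xs) = z t" for t by (simp add: z_def matrix_vector_mult_diff_distrib Axs)
    note tik = tikhonov_rescaling[OF assms(14-16) e_def q_def S_def q\<^sub>0_def]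
    \<comment> \<open>For positive \<open>t\<close> the reference rate is
      \<open>(e t)\<^sup>2\<close> divided by \<open>c\<close>, so limits relative to
      \<open>(e t)\<^sup>2\<close> are the asserted rates.\<close>
    have smallo: "g \<in> o[at_top](\<lambda>t. t powr (- r))"
      if "((\<lambda>t. g t / (e t)\<^sup>2) \<longlongrightarrow> 0) at_top" for g :: "real \<Rightarrow> real"
    proof (rule smalloI_tendsto)
      have "((\<lambda>t. c * (g t / (e t)\<^sup>2)) \<longlongrightarrow> 0) at_top" using that by (rule tendsto_mult_right_zero)
      moreover have "\<forall>\<^sub>F t in at_top. c * (g t / (e t)\<^sup>2) = g t / t powr (- r)"
        using eventually_gt_at_top[of 0] by eventually_elim (simp add: tik(4))
      ultimately show "((\<lambda>t. g t / t powr (- r)) \<longlongrightarrow> 0) at_top" by (rule Lim_transform_eventually)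
      show "\<forall>\<^sub>F t in at_top. t powr (- r) \<noteq> 0"
        using eventually_gt_at_top[of 0] by eventually_elim simp
    qed
    have z_div: "((\<lambda>t. (1 / (e t)\<^sup>2) *\<^sub>R z t) \<longlongrightarrow> 0) at_top" using lims(5) unfolding h Ah .
    have "((\<lambda>t. norm ((1 / (e t)\<^sup>2) *\<^sub>R z t)) \<longlongrightarrow> 0) at_top" using z_div by (rule tendsto_norm_zero)
    then have nz: "((\<lambda>t. norm (z t) / (e t)\<^sup>2) \<longlongrightarrow> 0) at_top" by simp
    show "(\<lambda>t. norm (A *v x t - b)) \<in> o[at_top](\<lambda>t. t powr (- r))"
      using smallo[OF nz] by (simp add: z_def)
    have "((\<lambda>t. A *v x t - b) \<longlongrightarrow> A *v xs - b) at_top"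
      by (intro tendsto_diff tendsto_const bounded_linear.tendsto[OF matrix_vector_mul_bounded_linear x_lim])
    then have "(z \<longlongrightarrow> 0) at_top" by (simp add: z_def[abs_def] Axs)
    \<comment> \<open>The penalty is removed from the augmented gap: relative to
      \<open>(e t)\<^sup>2\<close> it is a multiple of the product of \<open>z t\<close> with the
      rescaled residual, and both factors tend to 0.\<close>
    then have "((\<lambda>t. aug_gap f A b \<rho> \<mu>d xs (x t) / (e t)\<^sup>2 - \<rho> / 2 * (z t \<bullet> ((1 / (e t)\<^sup>2) *\<^sub>R z t)))
        \<longlongrightarrow> 0 - \<rho> / 2 * (0 \<bullet> (0 :: real^'m))) at_top"
      by (intro tendsto_intros lims(4) z_div)
    then have "((\<lambda>t. (lagrangian f A b (x t) \<mu>d - lagrangian f A b xs \<mu>d) / (e t)\<^sup>2) \<longlongrightarrow> 0) at_top"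
      by (simp add: aug_gap_def z_def add_divide_distrib)
    then show gap: "(\<lambda>t. lagrangian f A b (x t) \<mu>d - lagrangian f A b xs \<mu>d) \<in> o[at_top](\<lambda>t. t powr (- r))"
      by (rule smallo)
    \<comment> \<open>The objective gap is the Lagrangian gap minus
      \<open>\<mu>d \<bullet> z t\<close>, which inherits the feasibility rate.\<close>
    have "((\<lambda>t. \<mu>d \<bullet> ((1 / (e t)\<^sup>2) *\<^sub>R z t)) \<longlongrightarrow> \<mu>d \<bullet> 0) at_top"
      by (intro tendsto_intros z_div)
    then have "(\<lambda>t. \<mu>d \<bullet> z t) \<in> o[at_top](\<lambda>t. t powr (- r))" by (intro smallo) simp
    from sum_in_smallo(2)[OF gap this]
    have "(\<lambda>t. f (x t) - f xs) \<in> o[at_top](\<lambda>t. t powr (- r))"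
      by (simp add: lagrangian_def z_def Axs)
    then show "(\<lambda>t. \<bar>f (x t) - f xs\<bar>) \<in> o[at_top](\<lambda>t. t powr (- r))" by simp
    show "(\<lambda>t. norm (x' t)) \<in> o[at_top](\<lambda>t. t powr (- (r / 2)))"
    proof (rule smalloI_tendsto)
      have "((\<lambda>t. sqrt c * norm ((1 / e t) *\<^sub>R x' t)) \<longlongrightarrow> 0) at_top"
        by (intro tendsto_mult_right_zero tendsto_norm_zero lims(1))
      moreover have "\<forall>\<^sub>F t in at_top. sqrt c * norm ((1 / e t) *\<^sub>R x' t) = norm (x' t) / t powr (- (r / 2))"
        using eventually_gt_at_top[of 0] by eventually_elim (use \<open>c > 0\<close> in \<open>simp add: e_def\<close>)
      ultimately show "((\<lambda>t. norm (x' t) / t powr (- (r / 2))) \<longlongrightarrow> 0) at_top"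
        by (rule Lim_transform_eventually)
      show "\<forall>\<^sub>F t in at_top. t powr (- (r / 2)) \<noteq> 0"
        using eventually_gt_at_top[of 0] by eventually_elim simp
    qed
  qed
qed

end
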